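(* Let $A$ be a commutative ring. The following statements are equivalent. (i) $A$ is a Gelfand ring. (ii) $\operatorname{Max}(A)$ is the Zariski retraction of $\operatorname{Spec}(A)$. (iii) $\operatorname{Spec}(A)$ is a normal space with respect to the Zariski topology. (iv) If $f\in A$, then there exist $g,h\in A$ such that $(1+fg)(1+f'h)=0$, where $f'=1-f$. (v) If $\mathfrak{m}$ and $\mathfrak{m}'$ are distinct maximal ideals of $A$, then there exist $f\in A\setminus\mathfrak{m}$ and $g\in A\setminus\mathfrak{m}'$ such that $fg=0$. (vi) If $\mathfrak{m}$ is a maximal ideal of $A$, then the canonical map $\pi_{\mathfrak{m}}:A\rightarrow A_{\mathfrak{m}}$ is surjective. (vii) If $\mathfrak{m}$ is a maximal ideal of $A$, then $[\mathfrak{m}]=\Lambda(\mathfrak{m})$. (viii) If $\mathfrak{m}$ is a maximal ideal of $A$, then $\Lambda(\mathfrak{m})$ is a Zariski closed subset of $\operatorname{Spec}(A)$. (ix) If $\mathfrak{m}$ and $\mathfrak{m}'$ are distinct maximal ideals of $A$, then $\operatorname{Ker}\pi_{\mathfrak{m}}+\operatorname{Ker}\pi_{\mathfrak{m}'}=A$. (x) If $\mathfrak{m}$ and $\mathfrak{m}'$ are distinct maximal ideals of $A$, then there exists some $f\in A$ such that $f_{\mathfrak{m}}=0$ and $f_{\mathfrak{m}'}=1$. (xi) The map $\eta:\operatorname{Max}(A)\rightarrow\operatorname{Spec}(A)/\sim_{R}$ given by $\mathfrak{m}\mapsto[\mathfrak{m}]$ is a homeomorphism. (xii) If $\mathfrak{m}$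 is a maximal ideal of $A$, then $\Lambda(\mathfrak{m})=V(\operatorname{Ker}\pi_{\mathfrak{m}})$.
   Context: All rings are commutative (with unit). A ring $A$ is a Gelfand ring if each prime ideal of $A$ is contained in a unique maximal ideal of $A$. $\operatorname{Max}(A)$ is the set of maximal ideals, with the topology induced from the Zariski topology of $\operatorname{Spec}(A)$. For a prime $\mathfrak{p}$, $\Lambda(\mathfrak{p})=\{\mathfrak{q}\in\operatorname{Spec}(A):\mathfrak{q}\subseteq\mathfrak{p}\}$, $\pi_{\mathfrak{p}}:A\to A_{\mathfrak{p}}$ is the canonical ring map, and $f_{\mathfrak{p}}$ denotes the image of $f\in A$ under $\pi_{\mathfrak{p}}$. For an ideal $I$, $V(I)=\{\mathfrak{p}\in\operatorname{Spec}(A):I\subseteq\mathfrak{p}\}$. A subspace $Y$ of a topological space $X$ is a retraction of $X$ if there is a continuous map $\gamma:X\to Y$ with $\gamma(y)=y$ for all $y\in Y$; "Zariski retraction" means this with respect to the Zariski topology. A space is normal if any two disjoint closed subsets have disjoint open neighbourhoods (no separation axiom such as $T_1$ is assumed). On $X=\operatorname{Spec}(A)$ consider the relation $R=\{(\mathfrak{p},\mathfrak{q})\in X^{2}:\mathfrak{p}+\mathfrak{q}\neq A\}$, and let $\sim_{R}$ be the equivalence relation generated by $R$: $\mathfrak{p}\sim_{R}\mathfrak{q}$ iff there are primes $\mathfrak{p}_{1},\dots,\mathfrak{p}_{n}$ with $n\geq2$, $\mathfrak{p}_{1}=\mathfrak{p}$, $\mathfrak{p}_{n}=\mathfrak{q}$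 and $\mathfrak{p}_{i}+\mathfrak{p}_{i+1}\neq A$ for all $1\leq i\leq n-1$. Here $[\mathfrak{p}]$ denotes the equivalence class of $\mathfrak{p}$ under $\sim_{R}$, and $\operatorname{Spec}(A)/\sim_{R}$ carries the quotient topology of the Zariski topology on $\operatorname{Spec}(A)$. *)

theory Defs
  imports "HOL-Analysis.Analysis" "HOL-Algebra.RingHom"
begin

section \<open>The prime spectrum\<close>

definition Spec :: "('a, 'b) ring_scheme \<Rightarrow> 'a set set"
  where "Spec A = {P. primeideal P A}"

definition MaxSpec :: "('a, 'b) ring_scheme \<Rightarrow> 'a set set"
  where "MaxSpec A = {M. maximalideal M A}"

definition vanishing_locus :: "('a, 'b) ring_scheme \<Rightarrow> 'a set \<Rightarrow> 'a set set"
  where "vanishing_locus A I = {P \<in> Spec A. I \<subseteq> P}"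

definition generalizations :: "('a, 'b) ring_scheme \<Rightarrow> 'a set \<Rightarrow> 'a set set"  (\<open>\<Lambda>\<index> _\<close> [81] 80)
  where "\<Lambda>\<^bsub>A\<^esub> P = {Q \<in> Spec A. Q \<subseteq> P}"

definition zariski :: "('a, 'b) ring_scheme \<Rightarrow> 'a set topology"
  where "zariski A = topology (\<lambda>U. \<exists>I. ideal I A \<and> U = Spec A - vanishing_locus A I)"

definition gelfand_ring :: "('a, 'b) ring_scheme \<Rightarrow> bool"
  where "gelfand_ring A \<longleftrightarrow> cring A \<and> (\<forall>P \<in> Spec A. \<exists>!M. M \<in> MaxSpec A \<and> P \<subseteq> M)"

lemma (in cring) istopology_zariski:
  "istopology (\<lambda>U. \<exists>I. ideal I R \<and> U = Spec R - vanishing_locus R I)"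
  unfolding istopology_def
proof (rule conjI; intro allI impI)
  fix S T
  assume "\<exists>I. ideal I R \<and> S = Spec R - vanishing_locus R I" "\<exists>I. ideal I R \<and> T = Spec R - vanishing_locus R I"
  then obtain I J where I: "ideal I R" "S = Spec R - vanishing_locus R I"
    and J: "ideal J R" "T = Spec R - vanishing_locus R J"
    by blast
  have "I \<subseteq> P \<or> J \<subseteq> P" if P: "primeideal P R" and sub: "I \<inter> J \<subseteq> P" for P
  proof (rule ccontr)
    assume "\<not> ?thesis"
    then obtain a b where ab: "a \<in> I" "a \<notin> P" "b \<in> J" "b \<notin> P" by blast
    have c: "a \<in> carrier R" "b \<in> carrier R"
      using ab I(1) J(1) ideal.Icarr by metis+
    then have "a \<otimes> b \<in> I \<inter> J"
      using ab I(1) J(1) ideal.I_l_closed ideal.I_r_closed by (metis IntI)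
    then show False
      using primeideal.I_prime [OF P c] sub ab by blast
  qed
  then have "S \<inter> T = Spec R - vanishing_locus R (I \<inter> J)"
    unfolding I J vanishing_locus_def Spec_def by blast
  then show "\<exists>I. ideal I R \<and> S \<inter> T = Spec R - vanishing_locus R I"
    using i_intersect [OF I(1) J(1)] by blast
next
  fix K
  assume K: "\<forall>U\<in>K. \<exists>I. ideal I R \<and> U = Spec R - vanishing_locus R I"
  then obtain f where f: "\<And>U. U \<in> K \<Longrightarrow> ideal (f U) R \<and> U = Spec R - vanishing_locus R (f U)"
    by metis
  define G where "G = (\<Union>U\<in>K. f U)"
  have G: "G \<subseteq> carrier R"
    unfolding G_def using f additive_subgroup.a_subset ideal.axioms(1) by (metis UN_least)
  have G_sub: "Idl G \<subseteq> P \<longleftrightarrow> G \<subseteq> P" if "primeideal P R" for P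
    using genideal_self [OF G] genideal_minimal [OF primeideal.axioms(1) [OF that]]
    by (meson subset_trans)
  have "\<Union>K = (\<Union>U\<in>K. Spec R - vanishing_locus R (f U))"
    using f by blast
  also have "\<dots> = Spec R - vanishing_locus R (Idl G)"
    using G_sub by (auto simp: vanishing_locus_def Spec_def) (auto simp: G_def)
  finally have "\<Union>K = Spec R - vanishing_locus R (Idl G)" .
  then show "\<exists>I. ideal I R \<and> \<Union>K = Spec R - vanishing_locus R I"
    using genideal_ideal [OF G] by blast
qed

lemma (in cring) openin_zariski:
  "openin (zariski R) U \<longleftrightarrow> (\<exists>I. ideal I R \<and> U = Spec R - vanishing_locus R I)"
  unfolding zariski_def using topology_inverse' [OF istopology_zariski] by simp

lemma (in cring) topspace_zariski: "topspace (zariski R) = Spec R"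
proof -
  have "\<not> carrier R \<subseteq> P" if "primeideal P R" for P
    using primeideal.I_notcarr [OF that]
      additive_subgroup.a_subset [OF ideal.axioms(1) [OF primeideal.axioms(1) [OF that]]] by blast
  then have "vanishing_locus R (carrier R) = {}"
    unfolding vanishing_locus_def Spec_def by blast
  then have "openin (zariski R) (Spec R)"
    using openin_zariski oneideal by auto
  then have "Spec R \<subseteq> topspace (zariski R)"
    by (rule openin_subset)
  moreover have "topspace (zariski R) \<subseteq> Spec R"
    using openin_topspace [of "zariski R"] unfolding openin_zariski by auto
  ultimately show ?thesis by (rule subset_antisym [rotated])
qed

section \<open>The quotient of the spectrum\<close>

definition ideal_sum_rel :: "('a, 'b) ring_scheme \<Rightarrow> ('a set \<times> 'a set) set"
  where "ideal_sum_rel A = {(P, Q). P \<in> Spec A \<and> Q \<in> Spec A \<and> P <+>\<^bsub>A\<^esub> Q \<noteq> carrier A}"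

definition spec_rel :: "('a, 'b) ring_scheme \<Rightarrow> ('a set \<times> 'a set) set"
  where "spec_rel A = {(P, Q). \<exists>(n::nat) p. n \<ge> 2 \<and> p 1 = P \<and> p n = Q \<and>
    (\<forall>i \<in> {1..n}. p i \<in> Spec A) \<and>
    (\<forall>i \<in> {1..n - 1}. (p i, p (i + 1)) \<in> ideal_sum_rel A)}"

text \<open>
  The points are the classes \<open>r `` {x}\<close>; openness is tested on preimages under
  \<open>x \<mapsto> r `` {x}\<close>. This gives a topology for every relation \<open>r\<close>, and it is the usual
  quotient when \<open>r\<close> is an equivalence relation on the space.
\<close>

definition quotient_topology :: "'c topology \<Rightarrow> ('c \<times> 'c) set \<Rightarrow> 'c set topology"
  where "quotient_topology X r =
    topology (\<lambda>U. U \<subseteq> topspace X // r \<and> openin X {x \<in> topspace X. r `` {x} \<in> U})"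

lemma openin_quotient_topology:
  "openin (quotient_topology X r) U \<longleftrightarrow>
    U \<subseteq> topspace X // r \<and> openin X {x \<in> topspace X. r `` {x} \<in> U}"
proof -
  have "istopology (\<lambda>U. U \<subseteq> topspace X // r \<and> openin X {x \<in> topspace X. r `` {x} \<in> U})"
    unfolding istopology_def
  proof (rule conjI; intro allI impI)
    fix S T
    assume "S \<subseteq> topspace X // r \<and> openin X {x \<in> topspace X. r `` {x} \<in> S}"
      and "T \<subseteq> topspace X // r \<and> openin X {x \<in> topspace X. r `` {x} \<in> T}"
    moreover have "{x \<in> topspace X. r `` {x} \<in> S \<inter> T} =
        {x \<in> topspace X. r `` {x} \<in> S} \<inter> {x \<in> topspace X. r `` {x} \<in> T}"
      by blast
    ultimately show "S \<inter> T \<subseteq> topspace X // r \<and> openin X {x \<in> topspace X. r `` {x} \<in> S \<inter> T}"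
      by (metis (no_types, lifting) inf.coboundedI1 openin_Int)
  next
    fix K
    assume K: "\<forall>S\<in>K. S \<subseteq> topspace X // r \<and> openin X {x \<in> topspace X. r `` {x} \<in> S}"
    have *: "{x \<in> topspace X. r `` {x} \<in> \<Union>K} = (\<Union>S\<in>K. {x \<in> topspace X. r `` {x} \<in> S})"
      by blast
    have "openin X (\<Union>S\<in>K. {x \<in> topspace X. r `` {x} \<in> S})"
      using K by (intro openin_Union) blast
    with K show "\<Union>K \<subseteq> topspace X // r \<and> openin X {x \<in> topspace X. r `` {x} \<in> \<Union>K}"
      unfolding * by blast
  qed
  then show ?thesis
    unfolding quotient_topology_def using topology_inverse' by fastforce
qed

lemma quotient_map_quotient_topology:
  "quotient_map X (quotient_topology X r) (\<lambda>x. r `` {x})"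
proof -
  have *: "{x \<in> topspace X. r `` {x} \<in> topspace X // r} = topspace X"
    by (auto simp: quotientI)
  have "topspace (quotient_topology X r) = topspace X // r"
    using openin_quotient_topology [of X r "topspace X // r"]
      openin_quotient_topology [of X r "topspace (quotient_topology X r)"]
    by (metis * openin_subset openin_topspace order_refl subset_antisym)
  then show ?thesis
    unfolding quotient_map_def openin_quotient_topology by (auto simp: quotient_def)
qed

lemma spec_rel_eq_trancl:
  fixes A :: "('a, 'b) ring_scheme"
  shows "spec_rel A = (ideal_sum_rel A)\<^sup>+"
proof (rule subset_antisym; rule subrelI)
  fix P Q
  assume "(P, Q) \<in> spec_rel A"
  then obtain n :: nat and p where n: "n \<ge> 2" and p: "p 1 = P" "p n = Q"
    and step: "\<forall>i \<in> {1..n - 1}. (p i, p (i + 1)) \<in> ideal_sum_rel A"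
    unfolding spec_rel_def mem_Collect_eq case_prod_conv by (elim exE conjE)
  have "k \<ge> 2 \<Longrightarrow> k \<le> n \<Longrightarrow> (P, p k) \<in> (ideal_sum_rel A)\<^sup>+" for k
  proof (induction k rule: dec_induct)
    case base
    then show ?case
      using step p by (force simp: numeral_2_eq_2)
  next
    case (step k)
    then have "(p k, p (k + 1)) \<in> ideal_sum_rel A"
      using \<open>\<forall>i \<in> {1..n - 1}. _ i\<close> by auto
    then show ?case
      using step by (auto intro: trancl_into_trancl)
  qed
  then show "(P, Q) \<in> (ideal_sum_rel A)\<^sup>+"
    using n p by blast
next
  fix P Q
  assume "(P, Q) \<in> (ideal_sum_rel A)\<^sup>+"
  then show "(P, Q) \<in> spec_rel A"
  proof (induction rule: trancl_induct)
    case (base Q)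
    then have "P \<in> Spec A" "Q \<in> Spec A" by (auto simp: ideal_sum_rel_def)
    with base show ?case
      unfolding spec_rel_def
      by (auto intro!: exI [of _ "2::nat"] exI [of _ "\<lambda>i. if i = 1 then P else Q"])
  next
    case (step Q Q')
    then obtain n :: nat and p where n: "n \<ge> 2" and p: "p 1 = P" "p n = Q" "\<forall>i \<in> {1..n}. p i \<in> Spec A"
      and st: "\<forall>i \<in> {1..n - 1}. (p i, p (i + 1)) \<in> ideal_sum_rel A"
      unfolding spec_rel_def mem_Collect_eq case_prod_conv by (elim exE conjE)
    let ?p = "p(Suc n := Q')"
    have "Q' \<in> Spec A" using step by (auto simp: ideal_sum_rel_def)
    then have "\<forall>i \<in> {1..Suc n}. ?p i \<in> Spec A" using p by (auto simp: le_Suc_eq)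
    moreover have "(?p i, ?p (i + 1)) \<in> ideal_sum_rel A" if "i \<in> {1..Suc n - 1}" for i
    proof (cases "i = n")
      case True
      then show ?thesis using p step by auto
    next
      case False
      then show ?thesis using that st by auto
    qed
    moreover have "?p 1 = P" "?p (Suc n) = Q'" "Suc n \<ge> 2" using n p by auto
    ultimately show ?case
      unfolding spec_rel_def mem_Collect_eq case_prod_conv
      by - (intro exI [of _ "Suc n"] exI [of _ ?p] conjI ballI; blast)
  qed
qed

lemma (in cring) equiv_spec_rel: "equiv (Spec R) (spec_rel R)"
proof (rule equivI)
  have "ideal_sum_rel R \<subseteq> Spec R \<times> Spec R" by (auto simp: ideal_sum_rel_def)
  then show "spec_rel R \<subseteq> Spec R \<times> Spec R"
    unfolding spec_rel_eq_trancl by (rule trancl_subset_Sigma)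
  show "refl_on (Spec R) (spec_rel R)"
  proof (rule refl_onI)
    fix P assume P: "P \<in> Spec R"
    then have i: "primeideal P R" by (simp add: Spec_def)
    then have "P <+> P \<subseteq> P"
      using additive_subgroup.a_closed [OF ideal.axioms(1) [OF primeideal.axioms(1)]]
      by (fastforce simp: set_add_def')
    then have "P <+> P \<noteq> carrier R"
      using primeideal.I_notcarr [OF i]
        additive_subgroup.a_subset [OF ideal.axioms(1) [OF primeideal.axioms(1) [OF i]]] by blast
    with P show "(P, P) \<in> spec_rel R"
      unfolding spec_rel_eq_trancl ideal_sum_rel_def by auto
  qed
  have "sym (ideal_sum_rel R)"
  proof (rule symI)
    fix P Q assume "(P, Q) \<in> ideal_sum_rel R"
    moreover from this have "P \<subseteq> carrier R" "Q \<subseteq> carrier R"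
      by (auto simp: ideal_sum_rel_def Spec_def
          dest!: primeideal.axioms(1) ideal.axioms(1) additive_subgroup.a_subset)
    ultimately show "(Q, P) \<in> ideal_sum_rel R"
      unfolding ideal_sum_rel_def using set_add_comm [of P Q] by auto
  qed
  then show "sym (spec_rel R)"
    unfolding spec_rel_eq_trancl by (rule sym_trancl)
  show "trans (spec_rel R)"
    unfolding spec_rel_eq_trancl by (rule trans_trancl)
qed

section \<open>Localization\<close>

definition frac_rel :: "('a, 'b) ring_scheme \<Rightarrow> 'a set \<Rightarrow> (('a \<times> 'a) \<times> ('a \<times> 'a)) set"
  where "frac_rel A S = {((a, s), (b, t)). a \<in> carrier A \<and> b \<in> carrier A \<and> s \<in> S \<and> t \<in> S \<and>
    (\<exists>u \<in> S. u \<otimes>\<^bsub>A\<^esub> (a \<otimes>\<^bsub>A\<^esub> t \<ominus>\<^bsub>A\<^esub> b \<otimes>\<^bsub>A\<^esub> s) = \<zero>\<^bsub>A\<^esub>)}"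

definition fraction :: "('a, 'b) ring_scheme \<Rightarrow> 'a set \<Rightarrow> 'a \<Rightarrow> 'a \<Rightarrow> ('a \<times> 'a) set"
  where "fraction A S a s = frac_rel A S `` {(a, s)}"

text \<open>
  A fraction is its class of pairs (numerator, denominator). The operations are lifted from
  representatives by a union over both classes; for a multiplicative set \<open>S\<close> all members of that
  union coincide (lemmas \<open>fraction_mult\<close> and \<open>fraction_add\<close> below).
\<close>

definition localization :: "('a, 'b) ring_scheme \<Rightarrow> 'a set \<Rightarrow> ('a \<times> 'a) set ring"
  where "localization A S =
    \<lparr>carrier = (carrier A \<times> S) // frac_rel A S,
     mult = (\<lambda>X Y. \<Union>(a, s) \<in> X. \<Union>(b, t) \<in> Y. fraction A S (a \<otimes>\<^bsub>A\<^esub> b) (s \<otimes>\<^bsub>A\<^esub> t)),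
     one = fraction A S \<one>\<^bsub>A\<^esub> \<one>\<^bsub>A\<^esub>,
     zero = fraction A S \<zero>\<^bsub>A\<^esub> \<one>\<^bsub>A\<^esub>,
     add = (\<lambda>X Y. \<Union>(a, s) \<in> X. \<Union>(b, t) \<in> Y.
       fraction A S (a \<otimes>\<^bsub>A\<^esub> t \<oplus>\<^bsub>A\<^esub> b \<otimes>\<^bsub>A\<^esub> s) (s \<otimes>\<^bsub>A\<^esub> t))\<rparr>"

text \<open>The following three are meant for a prime ideal \<open>P\<close>.\<close>

abbreviation local_ring_at :: "('a, 'b) ring_scheme \<Rightarrow> 'a set \<Rightarrow> ('a \<times> 'a) set ring"
  where "local_ring_at A P \<equiv> localization A (carrier A - P)"

definition canonical_map :: "('a, 'b) ring_scheme \<Rightarrow> 'a set \<Rightarrow> 'a \<Rightarrow> ('a \<times> 'a) set"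
  where "canonical_map A P f = fraction A (carrier A - P) f \<one>\<^bsub>A\<^esub>"

abbreviation canonical_ker :: "('a, 'b) ring_scheme \<Rightarrow> 'a set \<Rightarrow> 'a set"
  where "canonical_ker A P \<equiv> a_kernel A (local_ring_at A P) (canonical_map A P)"

locale mult_set = cring A + submonoid S A for A (structure) and S
begin

lemma S_carr [simp]: "s \<in> S \<Longrightarrow> s \<in> carrier A"
  using subset by blast

lemma frac_rel_iff:
  "((a, s), (b, t)) \<in> frac_rel A S \<longleftrightarrow> a \<in> carrier A \<and> b \<in> carrier A \<and> s \<in> S \<and> t \<in> S \<and>
    (\<exists>u \<in> S. u \<otimes> (a \<otimes> t) = u \<otimes> (b \<otimes> s))"
proof -
  have "u \<otimes> (a \<otimes> t \<ominus> b \<otimes> s) = \<zero> \<longleftrightarrow> u \<otimes> (a \<otimes> t) = u \<otimes> (b \<otimes> s)"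
    if "a \<in> carrier A" "b \<in> carrier A" "s \<in> S" "t \<in> S" "u \<in> S" for u
  proof -
    have "u \<otimes> (a \<otimes> t \<ominus> b \<otimes> s) = u \<otimes> (a \<otimes> t) \<ominus> u \<otimes> (b \<otimes> s)"
      using that by (simp add: minus_eq r_distr r_minus)
    moreover have "x \<ominus> y = \<zero> \<longleftrightarrow> x = y" if "x \<in> carrier A" "y \<in> carrier A" for x y
      using that by (metis a_inv_closed minus_eq minus_equality minus_minus r_neg)
    ultimately show ?thesis
      using that by simp
  qed
  then show ?thesis
    unfolding frac_rel_def by auto
qed

lemma equiv_frac_rel: "equiv (carrier A \<times> S) (frac_rel A S)"
proof (rule equivI)
  show "frac_rel A S \<subseteq> (carrier A \<times> S) \<times> (carrier A \<times> S)"
    unfolding frac_rel_def by auto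
  show "refl_on (carrier A \<times> S) (frac_rel A S)"
    by (rule refl_onI) (use one_closed in \<open>force simp: frac_rel_iff\<close>)
  show "sym (frac_rel A S)"
    by (rule symI) (force simp: frac_rel_iff)
  show "trans (frac_rel A S)"
  proof (rule transI, clarify)
    fix a s b t c w
    assume "((a, s), (b, t)) \<in> frac_rel A S" "((b, t), (c, w)) \<in> frac_rel A S"
    then obtain u v where *: "a \<in> carrier A" "b \<in> carrier A" "c \<in> carrier A"
      "s \<in> S" "t \<in> S" "w \<in> S" "u \<in> S" "v \<in> S"
      and u: "u \<otimes> (a \<otimes> t) = u \<otimes> (b \<otimes> s)" and v: "v \<otimes> (b \<otimes> w) = v \<otimes> (c \<otimes> t)"
      by (auto simp: frac_rel_iff)
    have "(u \<otimes> v \<otimes> t) \<otimes> (a \<otimes> w) = (v \<otimes> w) \<otimes> (u \<otimes> (a \<otimes> t))"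
      using * by (simp add: m_ac)
    also have "\<dots> = (u \<otimes> s) \<otimes> (v \<otimes> (b \<otimes> w))"
      unfolding u using * by (simp add: m_ac)
    also have "\<dots> = (u \<otimes> v \<otimes> t) \<otimes> (c \<otimes> s)"
      unfolding v using * by (simp add: m_ac)
    finally show "((a, s), (c, w)) \<in> frac_rel A S"
      using * by (auto simp: frac_rel_iff intro!: bexI [of _ "u \<otimes> v \<otimes> t"])
  qed
qed

lemma fraction_eq_iff:
  assumes "a \<in> carrier A" "b \<in> carrier A" "s \<in> S" "t \<in> S"
  shows "fraction A S a s = fraction A S b t \<longleftrightarrow> (\<exists>u \<in> S. u \<otimes> (a \<otimes> t) = u \<otimes> (b \<otimes> s))"
  unfolding fraction_def
  using eq_equiv_class_iff [OF equiv_frac_rel, of "(a, s)" "(b, t)"] assms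
  by (auto simp: frac_rel_iff)

lemma fraction_eqI:
  assumes "a \<in> carrier A" "b \<in> carrier A" "s \<in> S" "t \<in> S" "a \<otimes> t = b \<otimes> s"
  shows "fraction A S a s = fraction A S b t"
  using assms one_closed by (auto simp: fraction_eq_iff)

lemma fraction_mem_carrier [simp]:
  "a \<in> carrier A \<Longrightarrow> s \<in> S \<Longrightarrow> fraction A S a s \<in> carrier (localization A S)"
  unfolding localization_def fraction_def by (auto intro: quotientI)

lemma carrier_localizationE:
  assumes "x \<in> carrier (localization A S)"
  obtains a s where "a \<in> carrier A" "s \<in> S" "x = fraction A S a s"
  using assms unfolding localization_def fraction_def by (auto elim!: quotientE)

lemma fraction_mult:
  assumes "a \<in> carrier A" "b \<in> carrier A" "s \<in> S" "t \<in> S"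
  shows "fraction A S a s \<otimes>\<^bsub>localization A S\<^esub> fraction A S b t = fraction A S (a \<otimes> b) (s \<otimes> t)"
proof -
  let ?f = "\<lambda>x y. fraction A S (fst x \<otimes> fst y) (snd x \<otimes> snd y)"
  have "congruent2 (frac_rel A S) (frac_rel A S) ?f"
  proof (rule congruent2_commuteI [OF equiv_frac_rel])
    fix y z assume "y \<in> carrier A \<times> S" "z \<in> carrier A \<times> S"
    then show "?f y z = ?f z y" by (auto simp: m_comm)
  next
    fix y z w
    assume w: "w \<in> carrier A \<times> S" and yz: "(y, z) \<in> frac_rel A S"
    obtain a s b t c r where eq: "y = (a, s)" "z = (b, t)" "w = (c, r)"
      by (meson surj_pair)
    with w yz obtain u where *: "a \<in> carrier A" "b \<in> carrier A" "c \<in> carrier A"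
      "s \<in> S" "t \<in> S" "r \<in> S" "u \<in> S" and u: "u \<otimes> (a \<otimes> t) = u \<otimes> (b \<otimes> s)"
      by (auto simp: frac_rel_iff)
    have "u \<otimes> (c \<otimes> a \<otimes> (r \<otimes> t)) = c \<otimes> r \<otimes> (u \<otimes> (a \<otimes> t))"
      using * by (simp add: m_ac)
    also have "\<dots> = u \<otimes> (c \<otimes> b \<otimes> (r \<otimes> s))"
      unfolding u using * by (simp add: m_ac)
    finally show "?f w y = ?f w z"
      using * by (auto simp: eq fraction_eq_iff)
  qed
  from UN_equiv_class2 [OF equiv_frac_rel equiv_frac_rel this, of "(a, s)" "(b, t)"] assms
  show ?thesis
    by (simp add: localization_def fraction_def case_prod_unfold)
qed

lemma fraction_add:
  assumes "a \<in> carrier A" "b \<in> carrier A" "s \<in> S" "t \<in> S"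
  shows "fraction A S a s \<oplus>\<^bsub>localization A S\<^esub> fraction A S b t =
    fraction A S (a \<otimes> t \<oplus> b \<otimes> s) (s \<otimes> t)"
proof -
  let ?f = "\<lambda>x y. fraction A S (fst x \<otimes> snd y \<oplus> fst y \<otimes> snd x) (snd x \<otimes> snd y)"
  have "congruent2 (frac_rel A S) (frac_rel A S) ?f"
  proof (rule congruent2_commuteI [OF equiv_frac_rel])
    fix y z assume "y \<in> carrier A \<times> S" "z \<in> carrier A \<times> S"
    then show "?f y z = ?f z y" by (auto simp: m_comm a_comm)
  next
    fix y z w
    assume w: "w \<in> carrier A \<times> S" and yz: "(y, z) \<in> frac_rel A S"
    obtain a s b t c r where eq: "y = (a, s)" "z = (b, t)" "w = (c, r)"
      by (meson surj_pair)
    with w yz obtain u where *: "a \<in> carrier A" "b \<in> carrier A" "c \<in> carrier A"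
      "s \<in> S" "t \<in> S" "r \<in> S" "u \<in> S" and u: "u \<otimes> (a \<otimes> t) = u \<otimes> (b \<otimes> s)"
      by (auto simp: frac_rel_iff)
    have "u \<otimes> ((c \<otimes> s \<oplus> a \<otimes> r) \<otimes> (r \<otimes> t)) =
        u \<otimes> (c \<otimes> s \<otimes> (r \<otimes> t)) \<oplus> r \<otimes> r \<otimes> (u \<otimes> (a \<otimes> t))"
      using * by (simp add: m_ac l_distr r_distr)
    also have "\<dots> = u \<otimes> ((c \<otimes> t \<oplus> b \<otimes> r) \<otimes> (r \<otimes> s))"
      unfolding u using * by (simp add: m_ac l_distr r_distr)
    finally show "?f w y = ?f w z"
      using * by (auto simp: eq fraction_eq_iff)
  qed
  from UN_equiv_class2 [OF equiv_frac_rel equiv_frac_rel this, of "(a, s)" "(b, t)"] assms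
  show ?thesis
    by (simp add: localization_def fraction_def case_prod_unfold)
qed

lemma one_localization: "\<one>\<^bsub>localization A S\<^esub> = fraction A S \<one> \<one>"
  and zero_localization: "\<zero>\<^bsub>localization A S\<^esub> = fraction A S \<zero> \<one>"
  by (simp_all add: localization_def)

lemma cring_localization: "cring (localization A S)"
proof (rule cringI)
  show "abelian_group (localization A S)"
  proof (rule abelian_groupI)
    fix x assume "x \<in> carrier (localization A S)"
    then obtain a s where *: "a \<in> carrier A" "s \<in> S" "x = fraction A S a s"
      by (elim carrier_localizationE)
    have "fraction A S \<zero> (s \<otimes> s) = fraction A S \<zero> \<one>"
      using * by (intro fraction_eqI) auto
    then have "fraction A S (\<ominus> a) s \<oplus>\<^bsub>localization A S\<^esub> x = \<zero>\<^bsub>localization A S\<^esub>"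
      using * by (simp add: fraction_add zero_localization l_minus l_neg)
    then show "\<exists>y\<in>carrier (localization A S). y \<oplus>\<^bsub>localization A S\<^esub> x = \<zero>\<^bsub>localization A S\<^esub>"
      using * by (intro bexI [of _ "fraction A S (\<ominus> a) s"]) auto
  qed (auto elim!: carrier_localizationE simp: fraction_add zero_localization
       m_ac a_ac l_distr r_distr intro!: fraction_eqI)
  show "comm_monoid (localization A S)"
    by (rule comm_monoidI)
      (auto elim!: carrier_localizationE simp: fraction_mult one_localization m_ac intro!: fraction_eqI)
next
  fix x y z
  assume "x \<in> carrier (localization A S)" "y \<in> carrier (localization A S)"
    "z \<in> carrier (localization A S)"
  then obtain a s b t c r where *: "a \<in> carrier A" "s \<in> S" "b \<in> carrier A" "t \<in> S"
    "c \<in> carrier A" "r \<in> S"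
    and eq: "x = fraction A S a s" "y = fraction A S b t" "z = fraction A S c r"
    by (elim carrier_localizationE)
  have "fraction A S ((a \<otimes> t \<oplus> b \<otimes> s) \<otimes> c) (s \<otimes> t \<otimes> r) =
      fraction A S (a \<otimes> c \<otimes> (t \<otimes> r) \<oplus> b \<otimes> c \<otimes> (s \<otimes> r)) (s \<otimes> r \<otimes> (t \<otimes> r))"
    using * by (intro fraction_eqI) (simp_all add: m_ac l_distr r_distr)
  then show "(x \<oplus>\<^bsub>localization A S\<^esub> y) \<otimes>\<^bsub>localization A S\<^esub> z =
      x \<otimes>\<^bsub>localization A S\<^esub> z \<oplus>\<^bsub>localization A S\<^esub> y \<otimes>\<^bsub>localization A S\<^esub> z"
    using * by (simp add: eq fraction_add fraction_mult)
qed

lemma ring_hom_fraction_one: "(\<lambda>a. fraction A S a \<one>) \<in> ring_hom A (localization A S)"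
  by (rule ring_hom_memI) (auto simp: fraction_add fraction_mult one_localization)

end

lemma (in primeideal) mult_set_compl: "mult_set R (carrier R - I)"
proof -
  have "submonoid (carrier R - I) R"
  proof
    show "\<one> \<in> carrier R - I"
      using one_imp_carrier I_notcarr by auto
  qed (use I_prime in auto)
  then show ?thesis
    by (simp add: mult_set_def is_cring)
qed

end

theory Submission
  imports Defs "HOL-Algebra.Ring_Divisibility"
begin

text \<open>
  The Gelfand property says that no prime lies below two maximal ideals, and every other condition
  is compared with this one. Two mechanisms do the work.

  \<^bold>\<open>From missing primes to equations.\<close> If \<open>S\<close> and \<open>T\<close> are multiplicative sets and no product
  \<open>s \<otimes> t\<close> vanishes, then Zorn's lemma yields a prime that avoids both
  (\<open>prime_avoiding_two_submonoids\<close>). Taking for \<open>S\<close>, \<open>T\<close> the complements of two maximal ideals, such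
  a prime would lie below both; so a Gelfand ring contains \<open>f \<notin> M\<close>, \<open>g \<notin> M'\<close> with \<open>f \<otimes> g = \<zero>\<close>.
  Taking for \<open>S\<close>, \<open>T\<close> the sets \<open>1 + f A\<close> and \<open>1 + (1 - f) A\<close>, such a prime would extend to a maximal
  ideal containing \<open>f\<close> and to one containing \<open>1 - f\<close>, which cannot coincide; so some product
  \<open>(1 + f g) (1 + (1 - f) h)\<close> vanishes. The second equation gives normality: two disjoint closed sets
  are the zero loci of comaximal ideals, and for \<open>f\<close> in the first and \<open>1 - f\<close> in the second the two
  factors define disjoint basic open neighbourhoods.

  \<^bold>\<open>From equations to localizations.\<close> In an equation \<open>f \<otimes> g = \<zero>\<close> as above, \<open>g\<close> dies in the
  localization at \<open>M\<close>. Hence no maximal ideal other than \<open>M\<close> contains the kernel of \<open>A \<rightarrow> A\<^sub>M\<close>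
  (\<open>gelfand_canonical_ker_subset\<close>). This identifies \<open>\<Lambda> M\<close> with the zero locus of that kernel, makes
  the kernels at distinct maximal ideals comaximal, and shows that each \<open>s \<notin> M\<close> is already invertible
  modulo the kernel (\<open>gelfand_local_inverse\<close>). The last fact is the surjectivity of \<open>A \<rightarrow> A\<^sub>M\<close>. It is
  also the continuity of the map that sends a prime to the maximal ideal above it, because it
  exhibits a basic open set on which \<open>s\<close> stays outside that maximal ideal. The fibres of this map are
  the classes of \<open>\<sim>\<^sub>R\<close>, so the retraction and the quotient topology describe the same space.

  The converse implications are short. A closed set contains every maximal ideal above each of its
  points, an open set contains every prime below each of its points, and a zero product lies in every
  prime; each of these excludes a prime \<open>P\<close> below two maximal ideals \<open>M\<close>, \<open>M'\<close>. For the criteria about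
  \<open>\<sim>\<^sub>R\<close>, the chain \<open>M, P, M'\<close> would put two maximal ideals into one class.
\<close>

text \<open>
  The retraction of the spectrum of a Gelfand ring. The description is meaningful only where
  the maximal ideal above \<open>P\<close> is unique.
\<close>

definition maximal_above :: "('a, 'b) ring_scheme \<Rightarrow> 'a set \<Rightarrow> 'a set"
  where "maximal_above A P = (THE M. M \<in> MaxSpec A \<and> P \<subseteq> M)"

context cring
begin

section \<open>Primes avoiding multiplicative sets\<close>

text \<open>
  The common Zorn argument: with \<open>S = {\<one>}\<close> it produces maximal ideals, and with a multiplicative set
  it produces primes.
\<close>

lemma ideal_maximal_avoiding:
  assumes "ideal I R" "I \<inter> S = {}"
  obtains J where "ideal J R" "I \<subseteq> J" "J \<inter> S = {}"
    "\<And>K. ideal K R \<Longrightarrow> J \<subseteq> K \<Longrightarrow> K \<inter> S = {} \<Longrightarrow> K = J"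
proof -
  let ?F = "{J. ideal J R \<and> I \<subseteq> J \<and> J \<inter> S = {}}"
  have "\<exists>M\<in>?F. \<forall>X\<in>?F. M \<subseteq> X \<longrightarrow> X = M"
  proof (rule subset_Zorn_nonempty)
    show "?F \<noteq> {}"
      using assms by blast
    fix C assume C: "C \<noteq> {}" "subset.chain ?F C"
    then have "subset.chain {I. ideal I R} C"
      by (auto simp: pred_on.chain_def)
    then have "ideal (\<Union>C) R"
      using chain_Union_is_ideal [of C] C(1) by simp
    moreover have "I \<subseteq> \<Union>C" "\<Union>C \<inter> S = {}"
      using C unfolding pred_on.chain_def by blast+
    ultimately show "\<Union>C \<in> ?F"
      by blast
  qed
  then obtain J where "J \<in> ?F" "\<forall>X\<in>?F. J \<subseteq> X \<longrightarrow> X = J" ..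
  then show thesis
    by (intro that [of J]) auto
qed

lemma ideal_subset_carrier: "ideal I R \<Longrightarrow> I \<subseteq> carrier R"
  by (rule subsetI) (rule ideal.Icarr)

lemma ideal_sum_subset:
  assumes "ideal I R" "ideal J R"
  shows "I \<subseteq> I <+> J" "J \<subseteq> I <+> J"
proof -
  have *: "X \<subseteq> X <+>\<^bsub>R\<^esub> Y" if "ideal X R" "ideal Y R" for X Y
  proof
    fix x assume x: "x \<in> X"
    have "\<zero> \<in> Y"
      using that(2) by (simp add: ideal_def additive_subgroup.zero_closed)
    moreover have "x = x \<oplus> \<zero>"
      using ideal.Icarr [OF that(1) x] by simp
    ultimately show "x \<in> X <+>\<^bsub>R\<^esub> Y"
      using x unfolding set_add_def' by blast
  qed
  show "I \<subseteq> I <+> J"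
    by (rule * [OF assms])
  have "I <+> J = J <+>\<^bsub>R\<^esub> I"
    by (rule set_add_comm [OF assms [THEN ideal_subset_carrier]])
  then show "J \<subseteq> I <+> J"
    using * [OF assms(2,1)] by simp
qed

text \<open>
  The extension of \<open>J\<close> by one element is kept as the sum \<open>J + (a)\<close>, so that its members can be split
  explicitly into a member of \<open>J\<close> and a multiple of \<open>a\<close>.
\<close>

lemma ideal_insert:
  assumes "ideal J R" "a \<in> carrier R"
  shows "ideal (J <+> PIdl a) R" "J \<subseteq> J <+> PIdl a" "a \<in> J <+> PIdl a"
  using add_ideals [OF assms(1) cgenideal_ideal [OF assms(2)]]
    ideal_sum_subset [OF assms(1) cgenideal_ideal [OF assms(2)]] cgenideal_self [OF assms(2)]
  by blast+

lemma ideal_insertE: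
  assumes "x \<in> J <+>\<^bsub>R\<^esub> PIdl a"
  obtains j r where "j \<in> J" "r \<in> carrier R" "x = j \<oplus> r \<otimes> a"
  using assms unfolding set_add_def' cgenideal_def by blast

lemma proper_ideal_subset_maximal:
  assumes "ideal I R" "I \<noteq> carrier R"
  obtains M where "M \<in> MaxSpec R" "I \<subseteq> M"
proof -
  have *: "K \<inter> {\<one>} = {} \<longleftrightarrow> K \<noteq> carrier R" if "ideal K R" for K
    using ideal.one_imp_carrier [OF that] by blast
  have "I \<inter> {\<one>} = {}"
    using * assms by blast
  then obtain J where J: "ideal J R" "I \<subseteq> J" "J \<inter> {\<one>} = {}"
    and max: "\<And>K. ideal K R \<Longrightarrow> J \<subseteq> K \<Longrightarrow> K \<inter> {\<one>} = {} \<Longrightarrow> K = J"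
    by (rule ideal_maximal_avoiding [OF assms(1)]) blast
  have "maximalideal J R"
  proof (rule maximalidealI [OF J(1)])
    show "carrier R \<noteq> J"
      using J(3) by auto
    show "K = J \<or> K = carrier R" if "ideal K R" "J \<subseteq> K" for K
      using * [OF that(1)] max [OF that] by blast
  qed
  with J(2) show thesis
    by (intro that [of J]) (auto simp: MaxSpec_def)
qed

text \<open>
  An ideal that is maximal among those avoiding \<open>S\<close> is prime: if \<open>a, b\<close> lie outside \<open>P\<close>, then both
  \<open>P + (a)\<close> and \<open>P + (b)\<close> meet \<open>S\<close>, and multiplying the two witnesses gives a member of \<open>S\<close> in
  \<open>P + (a b)\<close>. Hence \<open>a b\<close> is not in \<open>P\<close>.
\<close>

lemma prime_avoiding_submonoid:
  assumes S: "submonoid S R" and "\<zero> \<notin> S"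
  obtains P where "P \<in> Spec R" "P \<inter> S = {}"
proof -
  have "{\<zero>} \<inter> S = {}"
    using assms(2) by blast
  then obtain P where P: "ideal P R" "P \<inter> S = {}"
    and max: "\<And>K. ideal K R \<Longrightarrow> P \<subseteq> K \<Longrightarrow> K \<inter> S = {} \<Longrightarrow> K = P"
    by (rule ideal_maximal_avoiding [OF zeroideal]) blast
  interpret P: ideal P R by fact
  have meets: "\<exists>j\<in>P. \<exists>r\<in>carrier R. j \<oplus> r \<otimes> a \<in> S" if a: "a \<in> carrier R" "a \<notin> P" for a
  proof -
    have "P <+>\<^bsub>R\<^esub> PIdl a \<noteq> P"
      using ideal_insert(3) [OF P(1) a(1)] a(2) by blast
    then obtain x where "x \<in> P <+>\<^bsub>R\<^esub> PIdl a" "x \<in> S"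
      using max [OF ideal_insert(1,2) [OF P(1) a(1)]] by blast
    then show ?thesis
      by (blast elim: ideal_insertE)
  qed
  have "a \<in> P \<or> b \<in> P" if ab: "a \<in> carrier R" "b \<in> carrier R" "a \<otimes> b \<in> P" for a b
  proof (rule ccontr)
    assume "\<not> ?thesis"
    then have "a \<notin> P" "b \<notin> P"
      by blast+
    then obtain j r k q where *: "j \<in> P" "r \<in> carrier R" "j \<oplus> r \<otimes> a \<in> S"
      "k \<in> P" "q \<in> carrier R" "k \<oplus> q \<otimes> b \<in> S"
      using meets [OF ab(1)] meets [OF ab(2)] by blast
    have c: "j \<in> carrier R" "k \<in> carrier R"
      using * P.Icarr by auto
    have "(j \<oplus> r \<otimes> a) \<otimes> (k \<oplus> q \<otimes> b) = j \<otimes> (k \<oplus> q \<otimes> b) \<oplus> ((r \<otimes> a) \<otimes> k \<oplus> (r \<otimes> q) \<otimes> (a \<otimes> b))"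
      using * c ab by algebra
    also have "\<dots> \<in> P"
      by (rule P.a_closed [OF P.I_r_closed P.a_closed [OF P.I_l_closed P.I_l_closed]])
        (use * c ab in simp_all)
    finally show False
      using submonoid.m_closed [OF S *(3,6)] P(2) by blast
  qed
  moreover have "carrier R \<noteq> P"
    using submonoid.one_closed [OF S] P(2) by blast
  ultimately have "primeideal P R"
    using P(1) is_cring by (intro primeidealI) auto
  with P(2) show thesis
    by (intro that [of P]) (auto simp: Spec_def)
qed

text \<open>
  This is the source of all equations in the ring: the pairwise products of \<open>S\<close> and \<open>T\<close> form a
  multiplicative set that contains both, so that a prime avoiding it avoids \<open>S\<close> and \<open>T\<close>.
\<close>

lemma prime_avoiding_two_submonoids:
  assumes S: "submonoid S R" and T: "submonoid T R"
    and nz: "\<And>s t. s \<in> S \<Longrightarrow> t \<in> T \<Longrightarrow> s \<otimes> t \<noteq> \<zero>"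
  obtains P where "P \<in> Spec R" "P \<inter> S = {}" "P \<inter> T = {}"
proof -
  interpret S: submonoid S R by fact
  interpret T: submonoid T R by fact
  let ?U = "{s \<otimes> t | s t. s \<in> S \<and> t \<in> T}"
  have SU: "S \<subseteq> ?U"
  proof
    fix s assume "s \<in> S"
    moreover from this have "s = s \<otimes> \<one>"
      using S.subset by auto
    ultimately show "s \<in> ?U"
      using T.one_closed by blast
  qed
  have TU: "T \<subseteq> ?U"
  proof
    fix t assume "t \<in> T"
    moreover from this have "t = \<one> \<otimes> t"
      using T.subset by auto
    ultimately show "t \<in> ?U"
      using S.one_closed by blast
  qed
  have "submonoid ?U R"
  proof
    show "?U \<subseteq> carrier R"
      using S.subset T.subset by auto
    show "\<one> \<in> ?U"
      using SU S.one_closed by blast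
    fix x y assume "x \<in> ?U" "y \<in> ?U"
    then obtain s t s' t' where *: "s \<in> S" "t \<in> T" "s' \<in> S" "t' \<in> T"
      and xy: "x = s \<otimes> t" "y = s' \<otimes> t'"
      by blast
    then have "s \<in> carrier R" "s' \<in> carrier R" "t \<in> carrier R" "t' \<in> carrier R"
      using S.subset T.subset by auto
    then have "x \<otimes> y = (s \<otimes> s') \<otimes> (t \<otimes> t')"
      unfolding xy by (simp add: m_ac)
    then show "x \<otimes> y \<in> ?U"
      using S.m_closed [OF *(1,3)] T.m_closed [OF *(2,4)] by blast
  qed
  moreover have "\<zero> \<notin> ?U"
  proof
    assume "\<zero> \<in> ?U"
    then obtain s t where "s \<in> S" "t \<in> T" "s \<otimes> t = \<zero>"
      by force
    with nz show False
      by blast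
  qed
  ultimately obtain P where "P \<in> Spec R" "P \<inter> ?U = {}"
    by (rule prime_avoiding_submonoid)
  with SU TU show thesis
    by (intro that [of P]) blast+
qed

section \<open>Primes, maximal ideals and the Zariski topology\<close>

lemma MaxSpec_subset_Spec: "MaxSpec R \<subseteq> Spec R"
  unfolding MaxSpec_def Spec_def using maximalideal_prime by auto

lemma Spec_ideal: "P \<in> Spec R \<Longrightarrow> ideal P R"
  by (simp add: Spec_def primeideal.axioms(1))

lemma MaxSpec_ideal: "M \<in> MaxSpec R \<Longrightarrow> ideal M R"
  by (simp add: MaxSpec_def maximalideal.axioms(1))

lemma Spec_one_notin: "P \<in> Spec R \<Longrightarrow> \<one> \<notin> P"
  using ideal.one_imp_carrier [OF Spec_ideal, of P] primeideal.I_notcarr [of P R]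
  unfolding Spec_def by blast

lemma Spec_subset_maximal:
  assumes "P \<in> Spec R"
  obtains M where "M \<in> MaxSpec R" "P \<subseteq> M"
proof (rule proper_ideal_subset_maximal [OF Spec_ideal [OF assms]])
  show "P \<noteq> carrier R"
    using Spec_one_notin [OF assms] by blast
qed

lemma MaxSpec_eqI:
  assumes "M \<in> MaxSpec R" "ideal J R" "\<one> \<notin> J" "M \<subseteq> J"
  shows "J = M"
proof -
  have "J = M \<or> J = carrier R"
    using maximalideal.I_maximal [of M R J] ideal_subset_carrier [OF assms(2)] assms
    by (simp add: MaxSpec_def)
  with assms(3) show ?thesis
    by auto
qed

lemma ideal_sumE:
  assumes "I <+>\<^bsub>R\<^esub> J = carrier R"
  obtains a b where "a \<in> I" "b \<in> J" "a \<oplus> b = \<one>"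
proof -
  have "\<one> \<in> I <+> J"
    using assms by simp
  then show thesis
    using that unfolding set_add_def' by auto
qed

lemma distinct_maximal_sum:
  assumes "M \<in> MaxSpec R" "M' \<in> MaxSpec R" "M \<noteq> M'"
  shows "M <+> M' = carrier R"
proof (rule ccontr)
  assume neq: "M <+>\<^bsub>R\<^esub> M' \<noteq> carrier R"
  note i = assms(1,2) [THEN MaxSpec_ideal]
  have "\<one> \<notin> M <+>\<^bsub>R\<^esub> M'"
    using ideal.one_imp_carrier [OF add_ideals [OF i]] neq by blast
  then have "M <+>\<^bsub>R\<^esub> M' = M" "M <+>\<^bsub>R\<^esub> M' = M'"
    using MaxSpec_eqI [OF assms(1) add_ideals [OF i]] MaxSpec_eqI [OF assms(2) add_ideals [OF i]]
      ideal_sum_subset [OF i] by blast+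
  with assms(3) show False
    by simp
qed

lemma mult_set_Spec_compl: "P \<in> Spec R \<Longrightarrow> mult_set R (carrier R - P)"
  by (simp add: Spec_def primeideal.mult_set_compl)

lemma submonoid_Spec_compl: "P \<in> Spec R \<Longrightarrow> submonoid (carrier R - P) R"
  by (drule mult_set_Spec_compl) (rule mult_set.axioms(2))

lemma closedin_zariski:
  "closedin (zariski R) C \<longleftrightarrow> (\<exists>I. ideal I R \<and> C = vanishing_locus R I)"
proof -
  have "C \<subseteq> Spec R \<and> Spec R - C = Spec R - vanishing_locus R I \<longleftrightarrow> C = vanishing_locus R I" for I
    by (auto simp: vanishing_locus_def)
  then show ?thesis
    unfolding closedin_def topspace_zariski openin_zariski by blast
qed

lemma openin_basic:
  assumes "f \<in> carrier R"
  shows "openin (zariski R) {P \<in> Spec R. f \<notin> P}"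
proof -
  have "PIdl f \<subseteq> P \<longleftrightarrow> f \<in> P" if "P \<in> Spec R" for P
    using cgenideal_minimal [OF Spec_ideal [OF that]] cgenideal_self [OF assms] by blast
  then have "{P \<in> Spec R. f \<notin> P} = Spec R - vanishing_locus R (PIdl f)"
    unfolding vanishing_locus_def by blast
  then show ?thesis
    unfolding openin_zariski using cgenideal_ideal [OF assms] by blast
qed

text \<open>
  A larger prime leaves \<open>V(I)\<close> only if every smaller one does; this turns disjointness of open
  sets into the absence of a common smaller prime.
\<close>

lemma openin_zariski_generization:
  assumes "openin (zariski R) U" "Q \<in> U" "P \<in> Spec R" "P \<subseteq> Q"
  shows "P \<in> U"
  using assms unfolding openin_zariski vanishing_locus_def by blast

lemma closedin_zariski_singleton:
  assumes "M \<in> MaxSpec R"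
  shows "closedin (zariski R) {M}"
proof -
  have "vanishing_locus R M = {M}"
  proof
    show "{M} \<subseteq> vanishing_locus R M"
      using assms MaxSpec_subset_Spec by (auto simp: vanishing_locus_def)
    show "vanishing_locus R M \<subseteq> {M}"
      using MaxSpec_eqI [OF assms Spec_ideal Spec_one_notin]
      unfolding vanishing_locus_def by blast
  qed
  then show ?thesis
    unfolding closedin_zariski using MaxSpec_ideal [OF assms] by metis
qed

section \<open>The kernel of localization\<close>

text \<open>
  The equation \<open>f / 1 = b / s\<close> in the local ring, cleared of denominators. It reduces all later
  statements about localizations to equations in the ring itself.
\<close>

lemma canonical_map_eq_iff:
  assumes "P \<in> Spec R" "f \<in> carrier R" "b \<in> carrier R" "s \<in> carrier R - P"
  shows "canonical_map R P f = fraction R (carrier R - P) b s \<longleftrightarrow>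
    (\<exists>u\<in>carrier R - P. u \<otimes> (f \<otimes> s) = u \<otimes> b)"
proof -
  have "\<one> \<in> carrier R - P"
    using Spec_one_notin [OF assms(1)] by simp
  from mult_set.fraction_eq_iff [OF mult_set_Spec_compl [OF assms(1)] assms(2,3) this assms(4)]
  show ?thesis
    unfolding canonical_map_def using assms(3) by simp
qed

lemma canonical_map_eq_zero_iff:
  assumes "P \<in> Spec R" "f \<in> carrier R"
  shows "canonical_map R P f = \<zero>\<^bsub>local_ring_at R P\<^esub> \<longleftrightarrow> (\<exists>u\<in>carrier R - P. u \<otimes> f = \<zero>)"
  using canonical_map_eq_iff [OF assms, of \<zero> \<one>] assms(2) Spec_one_notin [OF assms(1)]
  by (simp add: localization_def)

lemma canonical_map_eq_one_iff:
  assumes "P \<in> Spec R" "f \<in> carrier R"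
  shows "canonical_map R P f = \<one>\<^bsub>local_ring_at R P\<^esub> \<longleftrightarrow> (\<exists>u\<in>carrier R - P. u \<otimes> f = u)"
  using canonical_map_eq_iff [OF assms, of \<one> \<one>] assms(2) Spec_one_notin [OF assms(1)]
  by (simp add: localization_def)

lemma canonical_ker_eq:
  "P \<in> Spec R \<Longrightarrow> canonical_ker R P = {f \<in> carrier R. \<exists>u\<in>carrier R - P. u \<otimes> f = \<zero>}"
  unfolding a_kernel_def' using canonical_map_eq_zero_iff by blast

lemma ideal_canonical_ker:
  assumes "P \<in> Spec R"
  shows "ideal (canonical_ker R P) R"
proof -
  note m = mult_set_Spec_compl [OF assms]
  have "ring_hom_ring R (local_ring_at R P) (canonical_map R P)"
    unfolding canonical_map_def
    by (rule ring_hom_ringI2 [OF ring_axioms cring.axioms(1) [OF mult_set.cring_localization [OF m]]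
          mult_set.ring_hom_fraction_one [OF m]])
  then show ?thesis
    by (rule ring_hom_ring.kernel_is_ideal)
qed

text \<open>
  A relation \<open>u \<otimes> f = \<zero>\<close> with \<open>u\<close> outside \<open>P\<close> puts \<open>f\<close> into every prime \<open>Q \<subseteq> P\<close>, since \<open>u \<notin> Q\<close>.
\<close>

lemma canonical_ker_subset:
  assumes "P \<in> Spec R" "Q \<in> Spec R" "Q \<subseteq> P"
  shows "canonical_ker R P \<subseteq> Q"
proof
  fix f assume "f \<in> canonical_ker R P"
  then obtain u where u: "f \<in> carrier R" "u \<in> carrier R - P" "u \<otimes> f = \<zero>"
    unfolding canonical_ker_eq [OF assms(1)] by blast
  have "\<zero> \<in> Q"
    using Spec_ideal [OF assms(2)] by (simp add: ideal_def additive_subgroup.zero_closed)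
  then have "u \<in> Q \<or> f \<in> Q"
    using primeideal.I_prime [of Q R u f] assms(2) u unfolding Spec_def by simp
  with u assms(3) show "f \<in> Q"
    by blast
qed

section \<open>Consequences of the Gelfand property\<close>

text \<open>
  Only uniqueness is at stake, because every prime lies below some maximal ideal.
\<close>

lemma gelfand_ring_iff:
  "gelfand_ring R \<longleftrightarrow>
    (\<forall>P\<in>Spec R. \<forall>M\<in>MaxSpec R. \<forall>M'\<in>MaxSpec R. P \<subseteq> M \<and> P \<subseteq> M' \<longrightarrow> M = M')"
proof -
  have "(\<exists>!M. M \<in> MaxSpec R \<and> P \<subseteq> M) \<longleftrightarrow>
      (\<forall>M\<in>MaxSpec R. \<forall>M'\<in>MaxSpec R. P \<subseteq> M \<and> P \<subseteq> M' \<longrightarrow> M = M')" if "P \<in> Spec R" for P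
    using Spec_subset_maximal [OF that] by metis
  then show ?thesis
    unfolding gelfand_ring_def using is_cring by simp
qed

lemma gelfand_ringI:
  assumes "\<And>P M M'. P \<in> Spec R \<Longrightarrow> M \<in> MaxSpec R \<Longrightarrow> M' \<in> MaxSpec R \<Longrightarrow>
    P \<subseteq> M \<Longrightarrow> P \<subseteq> M' \<Longrightarrow> M = M'"
  shows "gelfand_ring R"
  unfolding gelfand_ring_iff using assms by blast

lemma gelfand_ringD:
  assumes "gelfand_ring R" "P \<in> Spec R" "M \<in> MaxSpec R" "M' \<in> MaxSpec R" "P \<subseteq> M" "P \<subseteq> M'"
  shows "M = M'"
  using assms unfolding gelfand_ring_iff by blast

text \<open>
  If no product of the two complements vanished, some prime would avoid both complements, that is,
  lie below both maximal ideals.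
\<close>

lemma gelfand_separation:
  assumes "gelfand_ring R" "M \<in> MaxSpec R" "M' \<in> MaxSpec R" "M \<noteq> M'"
  shows "\<exists>f\<in>carrier R - M. \<exists>g\<in>carrier R - M'. f \<otimes> g = \<zero>"
proof (rule ccontr)
  assume "\<not> ?thesis"
  moreover have M: "M \<in> Spec R" "M' \<in> Spec R"
    using assms MaxSpec_subset_Spec by blast+
  ultimately obtain P where P: "P \<in> Spec R" "P \<inter> (carrier R - M) = {}" "P \<inter> (carrier R - M') = {}"
    using prime_avoiding_two_submonoids [OF M [THEN submonoid_Spec_compl]] by blast
  then have "P \<subseteq> M" "P \<subseteq> M'"
    using ideal_subset_carrier [OF Spec_ideal [OF P(1)]] by blast+
  then show False
    using gelfand_ringD [OF assms(1) P(1) assms(2,3)] assms(4) by blast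
qed

lemma separation_canonical_ker:
  assumes "M \<in> MaxSpec R" "f \<in> carrier R - M" "g \<in> carrier R" "f \<otimes> g = \<zero>"
  shows "g \<in> canonical_ker R M"
proof -
  have "M \<in> Spec R"
    using assms(1) MaxSpec_subset_Spec by blast
  from canonical_ker_eq [OF this] show ?thesis
    using assms by blast
qed

text \<open>
  A maximal ideal \<open>N \<noteq> M\<close> cannot contain the kernel: separation gives \<open>f \<otimes> g = \<zero>\<close> with \<open>f \<notin> M\<close> and
  \<open>g \<notin> N\<close>, and \<open>g\<close> belongs to the kernel. Hence the only maximal ideal above \<open>I\<close> is \<open>M\<close>.
\<close>

lemma gelfand_canonical_ker_subset:
  assumes "gelfand_ring R" "M \<in> MaxSpec R" "ideal I R" "\<one> \<notin> I" "canonical_ker R M \<subseteq> I"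
  shows "I \<subseteq> M"
proof -
  have "I \<noteq> carrier R"
    using assms(4) by blast
  then obtain N where N: "N \<in> MaxSpec R" "I \<subseteq> N"
    by (rule proper_ideal_subset_maximal [OF assms(3)])
  have "N = M"
  proof (rule ccontr)
    assume "N \<noteq> M"
    then obtain f g where "f \<in> carrier R - M" "g \<in> carrier R - N" "f \<otimes> g = \<zero>"
      using gelfand_separation [OF assms(1,2) N(1)] by blast
    then show False
      using separation_canonical_ker [OF assms(2), of f g] assms(5) N(2) by blast
  qed
  with N show ?thesis
    by simp
qed

text \<open>
  The kernel together with \<open>s\<close> generates the unit ideal, for otherwise that ideal would be contained
  in \<open>M\<close>. So \<open>1 = k + b s\<close> with \<open>k\<close> in the kernel, and multiplication by an annihilator \<open>u\<close> of \<open>k\<close>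
  gives \<open>u = u b s\<close>: the inverse of \<open>s\<close> in the local ring is the image of \<open>b\<close>.
\<close>

lemma gelfand_local_inverse:
  assumes "gelfand_ring R" "M \<in> MaxSpec R" "s \<in> carrier R - M"
  obtains b u where "b \<in> carrier R" "u \<in> carrier R - M" "u \<otimes> (b \<otimes> s) = u"
proof -
  have M: "M \<in> Spec R"
    using assms(2) MaxSpec_subset_Spec by blast
  note K = ideal_canonical_ker [OF M]
  have s: "s \<in> carrier R"
    using assms(3) by blast
  note I = ideal_insert [OF K s]
  have "\<one> \<in> canonical_ker R M <+>\<^bsub>R\<^esub> PIdl s"
    using gelfand_canonical_ker_subset [OF assms(1,2) I(1) _ I(2)] I(3) assms(3) by blast
  then obtain k b where k: "k \<in> canonical_ker R M" and b: "b \<in> carrier R" and 1: "\<one> = k \<oplus> b \<otimes> s"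
    by (rule ideal_insertE)
  then obtain u where kc: "k \<in> carrier R" and u: "u \<in> carrier R - M" "u \<otimes> k = \<zero>"
    unfolding canonical_ker_eq [OF M] by blast
  have uc: "u \<in> carrier R"
    using u by blast
  have "u = u \<otimes> (k \<oplus> b \<otimes> s)"
    using uc by (simp flip: 1)
  also have "\<dots> = u \<otimes> (b \<otimes> s)"
    using uc kc b s u(2) by (simp add: r_distr)
  finally show thesis
    using that b u(1) by simp
qed

lemma submonoid_one_plus_multiples:
  assumes f: "f \<in> carrier R"
  shows "submonoid {\<one> \<oplus> f \<otimes> g | g. g \<in> carrier R} R" (is "submonoid ?S R")
proof
  show "?S \<subseteq> carrier R"
    using f by auto
  have "\<one> = \<one> \<oplus> f \<otimes> \<zero>"
    using f by simp
  then show "\<one> \<in> ?S"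
    by blast
  fix x y assume "x \<in> ?S" "y \<in> ?S"
  then obtain g h where g: "g \<in> carrier R" "h \<in> carrier R" and xy: "x = \<one> \<oplus> f \<otimes> g" "y = \<one> \<oplus> f \<otimes> h"
    by blast
  have "x \<otimes> y = \<one> \<oplus> f \<otimes> (g \<oplus> h \<oplus> f \<otimes> g \<otimes> h)"
    unfolding xy using f g by algebra
  then show "x \<otimes> y \<in> ?S"
    using f g by blast
qed

text \<open>
  Avoiding \<open>1 + f A\<close> means precisely that \<open>f\<close> is not invertible modulo \<open>P\<close>, so \<open>P + (f)\<close> is proper.
\<close>

lemma maximal_above_avoiding_one_plus_multiples:
  assumes "P \<in> Spec R" "f \<in> carrier R" "P \<inter> {\<one> \<oplus> f \<otimes> g | g. g \<in> carrier R} = {}"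
  obtains M where "M \<in> MaxSpec R" "P \<subseteq> M" "f \<in> M"
proof -
  note P = Spec_ideal [OF assms(1)]
  note I = ideal_insert [OF P assms(2)]
  have "P <+>\<^bsub>R\<^esub> PIdl f \<noteq> carrier R"
  proof
    assume "P <+>\<^bsub>R\<^esub> PIdl f = carrier R"
    then have "\<one> \<in> P <+>\<^bsub>R\<^esub> PIdl f"
      by simp
    then obtain p r where p: "p \<in> P" and r: "r \<in> carrier R" and 1: "\<one> = p \<oplus> r \<otimes> f"
      by (rule ideal_insertE)
    have pc: "p \<in> carrier R"
      using p by (rule ideal.Icarr [OF P])
    have "\<one> \<oplus> f \<otimes> (\<ominus> r) = (p \<oplus> r \<otimes> f) \<oplus> f \<otimes> (\<ominus> r)"
      using 1 by simp
    also have "\<dots> = p"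
      using pc r assms(2) by algebra
    finally have "p = \<one> \<oplus> f \<otimes> (\<ominus> r)" ..
    moreover have "\<ominus> r \<in> carrier R"
      using r by simp
    ultimately show False
      using p assms(3) by blast
  qed
  then obtain M where "M \<in> MaxSpec R" "P <+>\<^bsub>R\<^esub> PIdl f \<subseteq> M"
    by (rule proper_ideal_subset_maximal [OF I(1)])
  then show thesis
    using that I(2,3) by blast
qed

lemma one_plus_multiple_notin:
  assumes "P \<in> Spec R" "f \<in> P" "g \<in> carrier R"
  shows "\<one> \<oplus> f \<otimes> g \<notin> P"
proof
  assume *: "\<one> \<oplus> f \<otimes> g \<in> P"
  interpret P: ideal P R
    by (rule Spec_ideal [OF assms(1)])
  have "(\<one> \<oplus> f \<otimes> g) \<ominus> f \<otimes> g \<in> P"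
    unfolding a_minus_def
    by (rule P.a_closed [OF * P.a_inv_closed [OF P.I_r_closed [OF assms(2,3)]]])
  moreover have "(\<one> \<oplus> f \<otimes> g) \<ominus> f \<otimes> g = \<one>"
    using P.Icarr [OF assms(2)] assms(3) by algebra
  ultimately show False
    using Spec_one_notin [OF assms(1)] by simp
qed

lemma complement_notin:
  assumes "P \<in> Spec R" "f \<in> P"
  shows "\<one> \<ominus> f \<notin> P"
proof -
  have "\<one> \<ominus> f = \<one> \<oplus> f \<otimes> (\<ominus> \<one>)"
    using ideal.Icarr [OF Spec_ideal [OF assms(1)] assms(2)] by algebra
  then show ?thesis
    using one_plus_multiple_notin [OF assms, of "\<ominus> \<one>"] by simp
qed

text \<open>
  Otherwise some prime avoids both \<open>1 + f A\<close> and \<open>1 + (1 - f) A\<close>. It then lies below a maximal ideal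
  containing \<open>f\<close> and below one containing \<open>1 - f\<close>; these are equal in a Gelfand ring, although no
  proper ideal contains both elements.
\<close>

lemma gelfand_zero_product:
  assumes "gelfand_ring R" "f \<in> carrier R"
  shows "\<exists>g\<in>carrier R. \<exists>h\<in>carrier R. (\<one> \<oplus> f \<otimes> g) \<otimes> (\<one> \<oplus> (\<one> \<ominus> f) \<otimes> h) = \<zero>"
proof (rule ccontr)
  assume no: "\<not> ?thesis"
  have f': "\<one> \<ominus> f \<in> carrier R"
    using assms(2) by simp
  let ?S = "\<lambda>f. {\<one> \<oplus> f \<otimes> g | g. g \<in> carrier R}"
  obtain P where P: "P \<in> Spec R" "P \<inter> ?S f = {}" "P \<inter> ?S (\<one> \<ominus> f) = {}"
  proof (rule prime_avoiding_two_submonoids)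
    show "submonoid (?S f) R" "submonoid (?S (\<one> \<ominus> f)) R"
      by (rule submonoid_one_plus_multiples, fact)+
    show "s \<otimes> t \<noteq> \<zero>" if "s \<in> ?S f" "t \<in> ?S (\<one> \<ominus> f)" for s t
      using no that by blast
  qed
  obtain M where M: "M \<in> MaxSpec R" "P \<subseteq> M" "f \<in> M"
    by (rule maximal_above_avoiding_one_plus_multiples [OF P(1) assms(2) P(2)])
  obtain M' where M': "M' \<in> MaxSpec R" "P \<subseteq> M'" "\<one> \<ominus> f \<in> M'"
    by (rule maximal_above_avoiding_one_plus_multiples [OF P(1) f' P(3)])
  have "M = M'"
    by (rule gelfand_ringD [OF assms(1) P(1) M(1) M'(1) M(2) M'(2)])
  then show False
    using complement_notin [of M f] M M' MaxSpec_subset_Spec by blast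
qed

section \<open>The retraction onto the maximal spectrum\<close>

lemma gelfand_maximal_above_eq:
  assumes "gelfand_ring R" "P \<in> Spec R" "M \<in> MaxSpec R" "P \<subseteq> M"
  shows "maximal_above R P = M"
  unfolding maximal_above_def
  by (rule the_equality) (use assms gelfand_ringD in blast)+

lemma gelfand_maximal_above:
  assumes "gelfand_ring R" "P \<in> Spec R"
  shows "maximal_above R P \<in> MaxSpec R" "P \<subseteq> maximal_above R P"
  using Spec_subset_maximal [OF assms(2)] gelfand_maximal_above_eq [OF assms] by metis+

lemma topspace_maximal: "topspace (subtopology (zariski R) (MaxSpec R)) = MaxSpec R"
  using MaxSpec_subset_Spec by (simp add: topspace_zariski Int_absorb1)

text \<open>
  Let \<open>U\<close> be the complement of \<open>V(I)\<close> and \<open>M \<in> U\<close> the maximal ideal above \<open>P\<close>; choose \<open>s \<in> I\<close> outside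
  \<open>M\<close>. The relation \<open>u (1 - b s) = 0\<close> of \<open>gelfand_local_inverse\<close> forces \<open>1 - b s \<in> Q\<close> for every prime
  \<open>Q\<close> with \<open>u \<notin> Q\<close>, so \<open>s\<close> is outside the maximal ideal above \<open>Q\<close> as well. Thus the basic open set
  of \<open>u\<close> is a neighbourhood of \<open>P\<close> that is mapped into \<open>U\<close>.
\<close>

lemma gelfand_continuous_maximal_above:
  assumes G: "gelfand_ring R"
  shows "continuous_map (zariski R) (subtopology (zariski R) (MaxSpec R)) (maximal_above R)"
proof -
  have "openin (zariski R) {P \<in> Spec R. maximal_above R P \<in> U}" if U: "openin (zariski R) U" for U
  proof (subst openin_subopen, rule ballI)
    fix P assume P: "P \<in> {P \<in> Spec R. maximal_above R P \<in> U}"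
    define M where "M = maximal_above R P"
    have M: "M \<in> MaxSpec R" "P \<subseteq> M" "M \<in> U"
      using P gelfand_maximal_above [OF G, of P] by (auto simp: M_def)
    obtain I where I: "ideal I R" "U = Spec R - vanishing_locus R I"
      using U unfolding openin_zariski by blast
    then obtain s where s: "s \<in> I" "s \<notin> M"
      using M(3) unfolding vanishing_locus_def by blast
    have sc: "s \<in> carrier R"
      using I(1) s(1) by (rule ideal.Icarr)
    with s have "s \<in> carrier R - M"
      by blast
    then obtain b u where b: "b \<in> carrier R" and u: "u \<in> carrier R - M" "u \<otimes> (b \<otimes> s) = u"
      by (rule gelfand_local_inverse [OF G M(1)])
    have uc: "u \<in> carrier R"
      using u by blast
    have "maximal_above R Q \<in> U" if Q: "Q \<in> Spec R" "u \<notin> Q" for Q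
    proof -
      define N where "N = maximal_above R Q"
      have N: "N \<in> MaxSpec R" "Q \<subseteq> N"
        using gelfand_maximal_above [OF G Q(1)] by (simp_all add: N_def)
      have NS: "N \<in> Spec R"
        using N(1) MaxSpec_subset_Spec by blast
      have "s \<notin> N"
      proof
        assume "s \<in> N"
        then have "b \<otimes> s \<in> N"
          using b by (rule ideal.I_l_closed [OF Spec_ideal [OF NS]])
        then have "\<one> \<ominus> b \<otimes> s \<notin> N"
          by (rule complement_notin [OF NS])
        moreover have "u \<otimes> (\<one> \<ominus> b \<otimes> s) = u \<ominus> u \<otimes> (b \<otimes> s)"
          using uc b sc by algebra
        then have "u \<otimes> (\<one> \<ominus> b \<otimes> s) = \<zero>"
          using u(2) uc by (simp add: a_minus_def r_neg)
        then have "u \<otimes> (\<one> \<ominus> b \<otimes> s) \<in> Q"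
          using Spec_ideal [OF Q(1)] by (simp add: ideal_def additive_subgroup.zero_closed)
        then have "u \<in> Q \<or> \<one> \<ominus> b \<otimes> s \<in> Q"
          using primeideal.I_prime [of Q R u "\<one> \<ominus> b \<otimes> s"] Q(1) uc b sc by (simp add: Spec_def)
        ultimately show False
          using Q(2) N(2) by blast
      qed
      with s(1) NS show ?thesis
        unfolding I N_def [symmetric] vanishing_locus_def by blast
    qed
    moreover have "P \<in> {Q \<in> Spec R. u \<notin> Q}"
      using P M(2) u(1) by blast
    ultimately show "\<exists>T. openin (zariski R) T \<and> P \<in> T \<and> T \<subseteq> {P \<in> Spec R. maximal_above R P \<in> U}"
      using openin_basic [OF uc] by (intro exI [of _ "{Q \<in> Spec R. u \<notin> Q}"]) blast
  qed
  then have "continuous_map (zariski R) (zariski R) (maximal_above R)"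
    unfolding continuous_map_def topspace_zariski
    using gelfand_maximal_above(1) [OF G] MaxSpec_subset_Spec by blast
  then show ?thesis
    using gelfand_maximal_above(1) [OF G]
    by (auto simp: continuous_map_in_subtopology topspace_zariski)
qed

text \<open>
  Conversely, let \<open>r\<close> be a retraction and \<open>P \<subseteq> M\<close>. If \<open>r P \<noteq> M\<close>, then the set of primes that \<open>r\<close>
  does not send to the closed point \<open>r P\<close> is open and contains \<open>M = r M\<close>, hence also the smaller
  prime \<open>P\<close>, which is absurd. So \<open>r P\<close> is the only maximal ideal above \<open>P\<close>.
\<close>

lemma gelfand_iff_retract:
  "gelfand_ring R \<longleftrightarrow> MaxSpec R retract_of_space zariski R"
proof
  assume G: "gelfand_ring R"
  have "maximal_above R M = M" if "M \<in> MaxSpec R" for M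
    using gelfand_maximal_above_eq [OF G _ that] that MaxSpec_subset_Spec by blast
  then show "MaxSpec R retract_of_space zariski R"
    unfolding retract_of_space_def topspace_zariski
    using gelfand_continuous_maximal_above [OF G] MaxSpec_subset_Spec by blast
next
  assume "MaxSpec R retract_of_space zariski R"
  then obtain r where r: "continuous_map (zariski R) (subtopology (zariski R) (MaxSpec R)) r"
    and fixed: "\<And>M. M \<in> MaxSpec R \<Longrightarrow> r M = M"
    unfolding retract_of_space_def by blast
  then have c: "continuous_map (zariski R) (zariski R) r" and rM: "\<And>P. P \<in> Spec R \<Longrightarrow> r P \<in> MaxSpec R"
    by (auto simp: continuous_map_in_subtopology topspace_zariski)
  have eq: "r P = M" if PM: "P \<in> Spec R" "M \<in> MaxSpec R" "P \<subseteq> M" for P M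
  proof (rule ccontr)
    assume neq: "r P \<noteq> M"
    let ?U = "{Q \<in> Spec R. r Q \<in> Spec R - {r P}}"
    have "openin (zariski R) (Spec R - {r P})"
      using openin_diff [OF openin_topspace closedin_zariski_singleton [OF rM [OF PM(1)]]]
      by (simp add: topspace_zariski)
    then have "openin (zariski R) ?U"
      by (rule openin_continuous_map_preimage [OF c, unfolded topspace_zariski])
    moreover have "M \<in> ?U"
      using PM(2) fixed neq MaxSpec_subset_Spec by auto
    ultimately have "P \<in> ?U"
      using PM(1,3) by (rule openin_zariski_generization)
    then show False
      by blast
  qed
  show "gelfand_ring R"
    by (rule gelfand_ringI) (metis eq)
qed

section \<open>Normality and the elementwise criteria\<close>

text \<open>
  Write \<open>1 = a + b\<close> with \<open>a \<in> I\<close> and \<open>b \<in> J\<close> and apply the hypothesis to \<open>f = a\<close>. The two factors are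
  congruent to \<open>1\<close> modulo \<open>I\<close> and modulo \<open>J\<close>, hence invertible at the points of \<open>V(I)\<close> and of \<open>V(J)\<close>.
  The maximal ideals in this role give separation of points, general ideals give normality.
\<close>

lemma zero_product_imp_separation:
  assumes *: "\<forall>f\<in>carrier R. \<exists>g\<in>carrier R. \<exists>h\<in>carrier R.
      (\<one> \<oplus> f \<otimes> g) \<otimes> (\<one> \<oplus> (\<one> \<ominus> f) \<otimes> h) = \<zero>"
    and IJ: "ideal I R" "ideal J R" "I <+> J = carrier R"
  obtains x y where "x \<in> carrier R" "y \<in> carrier R" "x \<otimes> y = \<zero>"
    "\<And>P. P \<in> Spec R \<Longrightarrow> I \<subseteq> P \<Longrightarrow> x \<notin> P" "\<And>P. P \<in> Spec R \<Longrightarrow> J \<subseteq> P \<Longrightarrow> y \<notin> P"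
proof -
  obtain a b where ab: "a \<in> I" "b \<in> J" "a \<oplus> b = \<one>"
    by (rule ideal_sumE [OF IJ(3)])
  have c: "a \<in> carrier R" "b \<in> carrier R"
    using ab ideal.Icarr [OF IJ(1)] ideal.Icarr [OF IJ(2)] by blast+
  have "\<one> \<ominus> a = (a \<oplus> b) \<ominus> a"
    by (simp add: ab(3))
  also have "\<dots> = b"
    using c by algebra
  finally obtain g h where gh: "g \<in> carrier R" "h \<in> carrier R"
    "(\<one> \<oplus> a \<otimes> g) \<otimes> (\<one> \<oplus> b \<otimes> h) = \<zero>"
    using * c(1) by metis
  show thesis
  proof (rule that [OF _ _ gh(3)])
    show "\<one> \<oplus> a \<otimes> g \<in> carrier R" "\<one> \<oplus> b \<otimes> h \<in> carrier R"
      using c gh by simp_all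
    show "\<one> \<oplus> a \<otimes> g \<notin> P" if "P \<in> Spec R" "I \<subseteq> P" for P
      using one_plus_multiple_notin [OF that(1) _ gh(1)] ab(1) that(2) by blast
    show "\<one> \<oplus> b \<otimes> h \<notin> P" if "P \<in> Spec R" "J \<subseteq> P" for P
      using one_plus_multiple_notin [OF that(1) _ gh(2)] ab(2) that(2) by blast
  qed
qed

lemma gelfand_iff_separation:
  "gelfand_ring R \<longleftrightarrow> (\<forall>M\<in>MaxSpec R. \<forall>M'\<in>MaxSpec R. M \<noteq> M' \<longrightarrow>
    (\<exists>f\<in>carrier R - M. \<exists>g\<in>carrier R - M'. f \<otimes> g = \<zero>))"
proof
  assume "gelfand_ring R"
  then show "\<forall>M\<in>MaxSpec R. \<forall>M'\<in>MaxSpec R. M \<noteq> M' \<longrightarrow>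
      (\<exists>f\<in>carrier R - M. \<exists>g\<in>carrier R - M'. f \<otimes> g = \<zero>)"
    using gelfand_separation by blast
next
  assume *: "\<forall>M\<in>MaxSpec R. \<forall>M'\<in>MaxSpec R. M \<noteq> M' \<longrightarrow>
      (\<exists>f\<in>carrier R - M. \<exists>g\<in>carrier R - M'. f \<otimes> g = \<zero>)"
  show "gelfand_ring R"
  proof (rule gelfand_ringI, rule ccontr)
    fix P M M'
    assume P: "P \<in> Spec R" and M: "M \<in> MaxSpec R" "M' \<in> MaxSpec R" "P \<subseteq> M" "P \<subseteq> M'"
      and "M \<noteq> M'"
    then obtain f g where fg: "f \<in> carrier R - M" "g \<in> carrier R - M'" "f \<otimes> g = \<zero>"
      using * by blast
    then have "f \<otimes> g \<in> P"
      using Spec_ideal [OF P] by (simp add: ideal_def additive_subgroup.zero_closed)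
    then have "f \<in> P \<or> g \<in> P"
      using primeideal.I_prime [of P R f g] P fg by (simp add: Spec_def)
    then show False
      using fg M by blast
  qed
qed

lemma gelfand_iff_zero_product:
  "gelfand_ring R \<longleftrightarrow> (\<forall>f\<in>carrier R. \<exists>g\<in>carrier R. \<exists>h\<in>carrier R.
    (\<one> \<oplus> f \<otimes> g) \<otimes> (\<one> \<oplus> (\<one> \<ominus> f) \<otimes> h) = \<zero>)" (is "_ \<longleftrightarrow> ?zp")
proof
  assume "gelfand_ring R"
  then show ?zp
    using gelfand_zero_product by blast
next
  assume zp: ?zp
  have "\<exists>f\<in>carrier R - M. \<exists>g\<in>carrier R - M'. f \<otimes> g = \<zero>"
    if M: "M \<in> MaxSpec R" "M' \<in> MaxSpec R" "M \<noteq> M'" for M M'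
  proof -
    have MS: "M \<in> Spec R" "M' \<in> Spec R"
      using M(1,2) MaxSpec_subset_Spec by blast+
    obtain x y where "x \<in> carrier R" "y \<in> carrier R" "x \<otimes> y = \<zero>"
      "\<And>P. P \<in> Spec R \<Longrightarrow> M \<subseteq> P \<Longrightarrow> x \<notin> P" "\<And>P. P \<in> Spec R \<Longrightarrow> M' \<subseteq> P \<Longrightarrow> y \<notin> P"
      by (rule zero_product_imp_separation [OF zp MS [THEN Spec_ideal] distinct_maximal_sum [OF M]]) blast
    with MS show ?thesis
      by blast
  qed
  then show "gelfand_ring R"
    unfolding gelfand_iff_separation by blast
qed

lemma disjoint_vanishing_loci_sum:
  assumes "ideal I R" "ideal J R" "vanishing_locus R I \<inter> vanishing_locus R J = {}"
  shows "I <+> J = carrier R"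
proof (rule ccontr)
  assume "I <+>\<^bsub>R\<^esub> J \<noteq> carrier R"
  then obtain M where "M \<in> MaxSpec R" "I <+>\<^bsub>R\<^esub> J \<subseteq> M"
    by (rule proper_ideal_subset_maximal [OF add_ideals [OF assms(1,2)]])
  then have "M \<in> vanishing_locus R I \<inter> vanishing_locus R J"
    using ideal_sum_subset [OF assms(1,2)] MaxSpec_subset_Spec
    unfolding vanishing_locus_def by blast
  then show False
    using assms(3) by blast
qed

lemma gelfand_iff_normal: "gelfand_ring R \<longleftrightarrow> normal_space (zariski R)"
proof
  assume G: "gelfand_ring R"
  show "normal_space (zariski R)"
    unfolding normal_space_def
  proof (intro allI impI, elim conjE)
    fix S T
    assume "closedin (zariski R) S" "closedin (zariski R) T" and dis: "disjnt S T"
    then obtain I J where IJ: "ideal I R" "ideal J R" "S = vanishing_locus R I" "T = vanishing_locus R J"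
      unfolding closedin_zariski by blast
    have sum: "I <+>\<^bsub>R\<^esub> J = carrier R"
      using disjoint_vanishing_loci_sum [OF IJ(1,2)] dis IJ(3,4) by (simp add: disjnt_def)
    obtain x y where xy: "x \<in> carrier R" "y \<in> carrier R" "x \<otimes> y = \<zero>"
      and x: "\<And>P. P \<in> Spec R \<Longrightarrow> I \<subseteq> P \<Longrightarrow> x \<notin> P" and y: "\<And>P. P \<in> Spec R \<Longrightarrow> J \<subseteq> P \<Longrightarrow> y \<notin> P"
      by (rule zero_product_imp_separation [OF G [unfolded gelfand_iff_zero_product] IJ(1,2) sum]) blast
    have "x \<in> P \<or> y \<in> P" if P: "P \<in> Spec R" for P
    proof -
      have "x \<otimes> y \<in> P"
        using xy Spec_ideal [OF P] by (simp add: ideal_def additive_subgroup.zero_closed)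
      then show ?thesis
        using primeideal.I_prime [of P R x y] P xy by (simp add: Spec_def)
    qed
    then have "disjnt {P \<in> Spec R. x \<notin> P} {P \<in> Spec R. y \<notin> P}"
      unfolding disjnt_def by blast
    moreover have "S \<subseteq> {P \<in> Spec R. x \<notin> P}" "T \<subseteq> {P \<in> Spec R. y \<notin> P}"
      using x y unfolding IJ vanishing_locus_def by blast+
    ultimately show "\<exists>U V. openin (zariski R) U \<and> openin (zariski R) V \<and> S \<subseteq> U \<and> T \<subseteq> V \<and> disjnt U V"
      using openin_basic xy(1,2) by blast
  qed
next
  assume N: "normal_space (zariski R)"
  show "gelfand_ring R"
  proof (rule gelfand_ringI, rule ccontr)
    fix P M M'
    assume P: "P \<in> Spec R" and M: "M \<in> MaxSpec R" "M' \<in> MaxSpec R" "P \<subseteq> M" "P \<subseteq> M'"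
      and "M \<noteq> M'"
    then have "disjnt {M} {M'}"
      by simp
    then obtain U V where U: "openin (zariski R) U" "{M} \<subseteq> U" and V: "openin (zariski R) V" "{M'} \<subseteq> V"
      and UV: "disjnt U V"
      using N closedin_zariski_singleton [OF M(1)] closedin_zariski_singleton [OF M(2)]
      unfolding normal_space_def by meson
    have "P \<in> U"
      by (rule openin_zariski_generization [OF U(1) _ P M(3)]) (use U in blast)
    moreover have "P \<in> V"
      by (rule openin_zariski_generization [OF V(1) _ P M(4)]) (use V in blast)
    ultimately show False
      using UV by (auto simp: disjnt_def)
  qed
qed

section \<open>Local criteria\<close>

lemma generalizations_subset_vanishing_ker:
  assumes "P \<in> Spec R"
  shows "\<Lambda>\<^bsub>R\<^esub> P \<subseteq> vanishing_locus R (canonical_ker R P)"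
  using canonical_ker_subset [OF assms] unfolding generalizations_def vanishing_locus_def by blast

text \<open>
  The two criteria are proved in one cycle: in a Gelfand ring \<open>\<Lambda> M\<close> is the zero locus of the kernel, a
  zero locus is closed, and if \<open>\<Lambda> M\<close> is closed, then a prime \<open>P \<subseteq> M\<close> has no maximal ideal above it
  other than \<open>M\<close>, because closed sets are stable under passage to larger primes.
\<close>

lemma gelfand_iff_closed_generalizations:
  "gelfand_ring R \<longleftrightarrow> (\<forall>M\<in>MaxSpec R. closedin (zariski R) (\<Lambda>\<^bsub>R\<^esub> M))"
  and gelfand_iff_generalizations_vanishing_ker:
  "gelfand_ring R \<longleftrightarrow> (\<forall>M\<in>MaxSpec R. \<Lambda>\<^bsub>R\<^esub> M = vanishing_locus R (canonical_ker R M))"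
proof -
  have V: "\<Lambda>\<^bsub>R\<^esub> M = vanishing_locus R (canonical_ker R M)"
    if G: "gelfand_ring R" and M: "M \<in> MaxSpec R" for M
  proof
    show "\<Lambda>\<^bsub>R\<^esub> M \<subseteq> vanishing_locus R (canonical_ker R M)"
      using generalizations_subset_vanishing_ker M MaxSpec_subset_Spec by blast
    show "vanishing_locus R (canonical_ker R M) \<subseteq> \<Lambda>\<^bsub>R\<^esub> M"
      using gelfand_canonical_ker_subset [OF G M Spec_ideal Spec_one_notin]
      unfolding generalizations_def vanishing_locus_def by blast
  qed
  have C: "closedin (zariski R) (\<Lambda>\<^bsub>R\<^esub> M)"
    if "M \<in> MaxSpec R" "\<Lambda>\<^bsub>R\<^esub> M = vanishing_locus R (canonical_ker R M)" for M
    using ideal_canonical_ker [of M] that MaxSpec_subset_Spec unfolding closedin_zariski by blast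
  have G: "gelfand_ring R" if cl: "\<forall>M\<in>MaxSpec R. closedin (zariski R) (\<Lambda>\<^bsub>R\<^esub> M)"
  proof (rule gelfand_ringI)
    fix P M M'
    assume P: "P \<in> Spec R" and M: "M \<in> MaxSpec R" "M' \<in> MaxSpec R" "P \<subseteq> M" "P \<subseteq> M'"
    then obtain I where I: "\<Lambda>\<^bsub>R\<^esub> M = vanishing_locus R I"
      using cl unfolding closedin_zariski by blast
    have "P \<in> \<Lambda>\<^bsub>R\<^esub> M"
      using P M(3) by (simp add: generalizations_def)
    then have "M' \<in> \<Lambda>\<^bsub>R\<^esub> M"
      using M(2,4) MaxSpec_subset_Spec unfolding I vanishing_locus_def by blast
    then have "M' \<subseteq> M"
      by (simp add: generalizations_def)
    moreover have "M \<in> Spec R"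
      using M(1) MaxSpec_subset_Spec by blast
    ultimately show "M = M'"
      using MaxSpec_eqI [OF M(2) Spec_ideal Spec_one_notin] by blast
  qed
  show "gelfand_ring R \<longleftrightarrow> (\<forall>M\<in>MaxSpec R. closedin (zariski R) (\<Lambda>\<^bsub>R\<^esub> M))"
  proof
    assume R: "gelfand_ring R"
    show "\<forall>M\<in>MaxSpec R. closedin (zariski R) (\<Lambda>\<^bsub>R\<^esub> M)"
      by (rule ballI) (rule C [OF _ V [OF R]])
  qed (rule G)
  show "gelfand_ring R \<longleftrightarrow> (\<forall>M\<in>MaxSpec R. \<Lambda>\<^bsub>R\<^esub> M = vanishing_locus R (canonical_ker R M))"
  proof
    assume R: "gelfand_ring R"
    show "\<forall>M\<in>MaxSpec R. \<Lambda>\<^bsub>R\<^esub> M = vanishing_locus R (canonical_ker R M)"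
      by (rule ballI) (rule V [OF R])
  next
    assume "\<forall>M\<in>MaxSpec R. \<Lambda>\<^bsub>R\<^esub> M = vanishing_locus R (canonical_ker R M)"
    then have "\<forall>M\<in>MaxSpec R. closedin (zariski R) (\<Lambda>\<^bsub>R\<^esub> M)"
      by (intro ballI C) simp_all
    then show "gelfand_ring R"
      by (rule G)
  qed
qed

text \<open>
  A fraction \<open>a / s\<close> is the image of \<open>a b\<close>, with \<open>b\<close> from \<open>gelfand_local_inverse\<close>. Conversely, if a
  prime \<open>Q\<close> contains the kernel and an element \<open>x \<notin> M\<close>, then a preimage \<open>b\<close> of \<open>1 / x\<close> makes \<open>1 - x b\<close>
  a member of the kernel, so \<open>Q\<close> contains both \<open>x b\<close> and \<open>1 - x b\<close>. Hence the zero locus of the kernel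
  is \<open>\<Lambda> M\<close>.
\<close>

lemma gelfand_iff_canonical_map_surj:
  "gelfand_ring R \<longleftrightarrow>
    (\<forall>M\<in>MaxSpec R. canonical_map R M ` carrier R = carrier (local_ring_at R M))"
proof
  assume G: "gelfand_ring R"
  show "\<forall>M\<in>MaxSpec R. canonical_map R M ` carrier R = carrier (local_ring_at R M)"
  proof (intro ballI subset_antisym)
    fix M assume M: "M \<in> MaxSpec R"
    then have MS: "M \<in> Spec R"
      using MaxSpec_subset_Spec by blast
    note m = mult_set_Spec_compl [OF MS]
    show "canonical_map R M ` carrier R \<subseteq> carrier (local_ring_at R M)"
      using mult_set.fraction_mem_carrier [OF m] Spec_one_notin [OF MS]
      unfolding canonical_map_def by blast
    show "carrier (local_ring_at R M) \<subseteq> canonical_map R M ` carrier R"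
    proof
      fix x assume "x \<in> carrier (local_ring_at R M)"
      then obtain a s where as: "a \<in> carrier R" "s \<in> carrier R - M"
        and x: "x = fraction R (carrier R - M) a s"
        by (rule mult_set.carrier_localizationE [OF m])
      obtain b u where b: "b \<in> carrier R" and u: "u \<in> carrier R - M" "u \<otimes> (b \<otimes> s) = u"
        by (rule gelfand_local_inverse [OF G M as(2)])
      have c: "s \<in> carrier R" "u \<in> carrier R"
        using as u by blast+
      have "u \<otimes> (a \<otimes> b \<otimes> s) = a \<otimes> (u \<otimes> (b \<otimes> s))"
        using c as(1) b by (simp add: m_ac)
      also have "\<dots> = u \<otimes> a"
        using u(2) c as(1) by (simp add: m_comm)
      finally have "canonical_map R M (a \<otimes> b) = x"
        unfolding x using canonical_map_eq_iff [OF MS _ as(1,2), of "a \<otimes> b"] as(1) b u(1) by blast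
      then show "x \<in> canonical_map R M ` carrier R"
        using as(1) b by blast
    qed
  qed
next
  assume surj: "\<forall>M\<in>MaxSpec R. canonical_map R M ` carrier R = carrier (local_ring_at R M)"
  have "\<Lambda>\<^bsub>R\<^esub> M = vanishing_locus R (canonical_ker R M)" if M: "M \<in> MaxSpec R" for M
  proof
    have MS: "M \<in> Spec R"
      using M MaxSpec_subset_Spec by blast
    note m = mult_set_Spec_compl [OF MS]
    show "\<Lambda>\<^bsub>R\<^esub> M \<subseteq> vanishing_locus R (canonical_ker R M)"
      by (rule generalizations_subset_vanishing_ker [OF MS])
    have "Q \<subseteq> M" if Q: "Q \<in> Spec R" "canonical_ker R M \<subseteq> Q" for Q
    proof (rule ccontr)
      assume "\<not> Q \<subseteq> M"
      then obtain x where x: "x \<in> Q" "x \<notin> M"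
        by blast
      have xc: "x \<in> carrier R"
        using ideal.Icarr [OF Spec_ideal [OF Q(1)] x(1)] .
      then have xS: "x \<in> carrier R - M"
        using x by blast
      have "fraction R (carrier R - M) \<one> x \<in> canonical_map R M ` carrier R"
        using surj M mult_set.fraction_mem_carrier [OF m one_closed xS] by blast
      then obtain b where b: "b \<in> carrier R" "canonical_map R M b = fraction R (carrier R - M) \<one> x"
        by (metis imageE)
      then obtain u where u: "u \<in> carrier R - M" "u \<otimes> (b \<otimes> x) = u \<otimes> \<one>"
        using canonical_map_eq_iff [OF MS b(1) one_closed xS] by blast
      have uc: "u \<in> carrier R"
        using u by blast
      have "u \<otimes> (\<one> \<ominus> x \<otimes> b) = u \<ominus> u \<otimes> (b \<otimes> x)"
        using uc b xc by algebra
      also have "\<dots> = \<zero>"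
        using u(2) uc by (simp add: a_minus_def r_neg)
      finally have "\<one> \<ominus> x \<otimes> b \<in> canonical_ker R M"
        using u(1) b(1) xc unfolding canonical_ker_eq [OF MS] by blast
      then have "\<one> \<ominus> x \<otimes> b \<in> Q"
        using Q(2) by blast
      moreover have "x \<otimes> b \<in> Q"
        by (rule ideal.I_r_closed [OF Spec_ideal [OF Q(1)] x(1) b(1)])
      ultimately show False
        using complement_notin [OF Q(1)] by blast
    qed
    then show "vanishing_locus R (canonical_ker R M) \<subseteq> \<Lambda>\<^bsub>R\<^esub> M"
      unfolding generalizations_def vanishing_locus_def by blast
  qed
  then show "gelfand_ring R"
    unfolding gelfand_iff_generalizations_vanishing_ker by blast
qed

text \<open>
  Again one cycle. A maximal ideal above the sum of the two kernels would be contained in both \<open>M\<close>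
  and \<open>M'\<close>. If \<open>1 = a + b\<close> with \<open>a\<close> and \<open>b\<close> in the two kernels, then \<open>a\<close> is the element with images
  \<open>0\<close> and \<open>1\<close>. From such an element \<open>f\<close>, the annihilator of \<open>f\<close> outside \<open>M\<close> and \<open>f \<notin> M'\<close> itself form
  a separating pair.
\<close>

lemma gelfand_iff_ker_comaximal:
  "gelfand_ring R \<longleftrightarrow> (\<forall>M\<in>MaxSpec R. \<forall>M'\<in>MaxSpec R. M \<noteq> M' \<longrightarrow>
    canonical_ker R M <+> canonical_ker R M' = carrier R)" (is "_ \<longleftrightarrow> ?comax")
  and gelfand_iff_interpolation:
  "gelfand_ring R \<longleftrightarrow> (\<forall>M\<in>MaxSpec R. \<forall>M'\<in>MaxSpec R. M \<noteq> M' \<longrightarrow>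
    (\<exists>f\<in>carrier R. canonical_map R M f = \<zero>\<^bsub>local_ring_at R M\<^esub> \<and>
      canonical_map R M' f = \<one>\<^bsub>local_ring_at R M'\<^esub>))" (is "_ \<longleftrightarrow> ?interp")
proof -
  have 1: ?comax if G: "gelfand_ring R"
  proof (intro ballI impI, rule ccontr)
    fix M M' assume M: "M \<in> MaxSpec R" "M' \<in> MaxSpec R" "M \<noteq> M'"
      and neq: "canonical_ker R M <+>\<^bsub>R\<^esub> canonical_ker R M' \<noteq> carrier R"
    have "M \<in> Spec R" "M' \<in> Spec R"
      using M MaxSpec_subset_Spec by blast+
    note K = this [THEN ideal_canonical_ker]
    obtain N where N: "N \<in> MaxSpec R" "canonical_ker R M <+>\<^bsub>R\<^esub> canonical_ker R M' \<subseteq> N"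
      using neq by (rule proper_ideal_subset_maximal [OF add_ideals [OF K]])
    then have sub: "canonical_ker R M \<subseteq> N" "canonical_ker R M' \<subseteq> N"
      using ideal_sum_subset [OF K] by blast+
    have NS: "N \<in> Spec R"
      using N MaxSpec_subset_Spec by blast
    note NI = Spec_ideal [OF NS] Spec_one_notin [OF NS]
    have "N \<subseteq> M" "N \<subseteq> M'"
      by (rule gelfand_canonical_ker_subset [OF G M(1) NI sub(1)]
          gelfand_canonical_ker_subset [OF G M(2) NI sub(2)])+
    then show False
      using gelfand_ringD [OF G NS M(1,2)] M(3) by blast
  qed
  have 2: ?interp if comax: ?comax
  proof (intro ballI impI)
    fix M M' assume M: "M \<in> MaxSpec R" "M' \<in> MaxSpec R" "M \<noteq> M'"
    then have MS: "M \<in> Spec R" "M' \<in> Spec R"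
      using MaxSpec_subset_Spec by blast+
    have "canonical_ker R M <+>\<^bsub>R\<^esub> canonical_ker R M' = carrier R"
      using comax M by blast
    then obtain a b where ab: "a \<in> canonical_ker R M" "b \<in> canonical_ker R M'" "a \<oplus> b = \<one>"
      by (rule ideal_sumE)
    then obtain u v where a: "a \<in> carrier R" "u \<in> carrier R - M" "u \<otimes> a = \<zero>"
      and b: "b \<in> carrier R" "v \<in> carrier R - M'" "v \<otimes> b = \<zero>"
      unfolding canonical_ker_eq [OF MS(1)] canonical_ker_eq [OF MS(2)] by blast
    have v: "v \<in> carrier R"
      using b by blast
    have "v \<otimes> a = v \<otimes> (a \<oplus> b)"
      using v a(1) b(1,3) by (simp add: r_distr)
    then have "v \<otimes> a = v"
      using ab(3) v by simp
    then show "\<exists>f\<in>carrier R. canonical_map R M f = \<zero>\<^bsub>local_ring_at R M\<^esub> \<and>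
        canonical_map R M' f = \<one>\<^bsub>local_ring_at R M'\<^esub>"
      using a b canonical_map_eq_zero_iff [OF MS(1)] canonical_map_eq_one_iff [OF MS(2)] by blast
  qed
  have 3: "gelfand_ring R" if interp: ?interp
    unfolding gelfand_iff_separation
  proof (intro ballI impI)
    fix M M' assume M: "M \<in> MaxSpec R" "M' \<in> MaxSpec R" "M \<noteq> M'"
    then have MS: "M \<in> Spec R" "M' \<in> Spec R"
      using MaxSpec_subset_Spec by blast+
    obtain f where f: "f \<in> carrier R" "canonical_map R M f = \<zero>\<^bsub>local_ring_at R M\<^esub>"
        "canonical_map R M' f = \<one>\<^bsub>local_ring_at R M'\<^esub>"
      using interp M by blast
    then obtain u v where u: "u \<in> carrier R - M" "u \<otimes> f = \<zero>" and v: "v \<in> carrier R - M'" "v \<otimes> f = v"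
      using canonical_map_eq_zero_iff [OF MS(1) f(1)] canonical_map_eq_one_iff [OF MS(2) f(1)] by blast
    have "f \<notin> M'"
    proof
      assume "f \<in> M'"
      then have "v \<otimes> f \<in> M'"
        by (rule ideal.I_l_closed [OF Spec_ideal [OF MS(2)]]) (use v in blast)
      then show False
        using v by simp
    qed
    then show "\<exists>f\<in>carrier R - M. \<exists>g\<in>carrier R - M'. f \<otimes> g = \<zero>"
      using u f(1) by blast
  qed
  show "gelfand_ring R \<longleftrightarrow> ?comax"
    by (rule iffI [OF 1 3 [OF 2]])
  show "gelfand_ring R \<longleftrightarrow> ?interp"
    by (rule iffI [OF 2 [OF 1] 3])
qed

section \<open>The quotient of the spectrum\<close>

text \<open>
  A sum of two ideals is proper exactly if a maximal ideal contains it, so the generating relation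
  says that two primes share a maximal ideal.
\<close>

lemma ideal_sum_rel_iff:
  "(P, Q) \<in> ideal_sum_rel R \<longleftrightarrow>
    P \<in> Spec R \<and> Q \<in> Spec R \<and> (\<exists>M\<in>MaxSpec R. P \<subseteq> M \<and> Q \<subseteq> M)"
proof -
  have "P <+> Q \<noteq> carrier R \<longleftrightarrow> (\<exists>M\<in>MaxSpec R. P \<subseteq> M \<and> Q \<subseteq> M)"
    if PQ: "P \<in> Spec R" "Q \<in> Spec R"
  proof
    note I = PQ [THEN Spec_ideal]
    assume "P <+>\<^bsub>R\<^esub> Q \<noteq> carrier R"
    then obtain M where "M \<in> MaxSpec R" "P <+>\<^bsub>R\<^esub> Q \<subseteq> M"
      by (rule proper_ideal_subset_maximal [OF add_ideals [OF I]])
    then show "\<exists>M\<in>MaxSpec R. P \<subseteq> M \<and> Q \<subseteq> M"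
      using ideal_sum_subset [OF I] by blast
  next
    assume "\<exists>M\<in>MaxSpec R. P \<subseteq> M \<and> Q \<subseteq> M"
    then obtain M where M: "M \<in> MaxSpec R" "P \<subseteq> M" "Q \<subseteq> M"
      by blast
    then have MS: "M \<in> Spec R"
      using MaxSpec_subset_Spec by blast
    show "P <+>\<^bsub>R\<^esub> Q \<noteq> carrier R"
    proof
      assume "P <+>\<^bsub>R\<^esub> Q = carrier R"
      then obtain a b where ab: "a \<in> P" "b \<in> Q" "a \<oplus> b = \<one>"
        by (rule ideal_sumE)
      have "a \<oplus> b \<in> M"
        by (rule additive_subgroup.a_closed [OF ideal.axioms(1) [OF Spec_ideal [OF MS]]])
          (use ab M in blast)+
      then show False
        using ab(3) Spec_one_notin [OF MS] by simp
    qed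
  qed
  then show ?thesis
    unfolding ideal_sum_rel_def by blast
qed

lemma ideal_sum_rel_subset: "ideal_sum_rel R \<subseteq> spec_rel R"
  unfolding spec_rel_eq_trancl by (rule subsetI) (rule r_into_trancl')

text \<open>
  When the maximal ideal above a prime is unique, sharing it is already transitive, so chains of
  length greater than one identify nothing new.
\<close>

lemma gelfand_spec_rel_iff:
  assumes G: "gelfand_ring R"
  shows "(P, Q) \<in> spec_rel R \<longleftrightarrow>
    P \<in> Spec R \<and> Q \<in> Spec R \<and> maximal_above R P = maximal_above R Q"
proof
  assume "(P, Q) \<in> spec_rel R"
  then show "P \<in> Spec R \<and> Q \<in> Spec R \<and> maximal_above R P = maximal_above R Q"
    unfolding spec_rel_eq_trancl
  proof (induction rule: trancl_induct)
    case (base Q)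
    then show ?case
      unfolding ideal_sum_rel_iff using gelfand_maximal_above_eq [OF G] by metis
  next
    case (step Q Q')
    then show ?case
      unfolding ideal_sum_rel_iff using gelfand_maximal_above_eq [OF G] by metis
  qed
next
  assume "P \<in> Spec R \<and> Q \<in> Spec R \<and> maximal_above R P = maximal_above R Q"
  then have "(P, Q) \<in> ideal_sum_rel R"
    unfolding ideal_sum_rel_iff using gelfand_maximal_above [OF G] by metis
  then show "(P, Q) \<in> spec_rel R"
    using ideal_sum_rel_subset by blast
qed

text \<open>
  Two maximal ideals above a common prime \<open>P\<close> are joined by the chain \<open>M, P, M'\<close>. This gives the
  converse of both criteria that involve the equivalence classes.
\<close>

lemma spec_rel_class_eq_imp_gelfand:
  assumes "\<And>M M'. M \<in> MaxSpec R \<Longrightarrow> M' \<in> MaxSpec R \<Longrightarrow> (M, M') \<in> spec_rel R \<Longrightarrow> M = M'"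
  shows "gelfand_ring R"
proof (rule gelfand_ringI)
  fix P M M'
  assume P: "P \<in> Spec R" and M: "M \<in> MaxSpec R" "M' \<in> MaxSpec R" "P \<subseteq> M" "P \<subseteq> M'"
  then have "(M, P) \<in> ideal_sum_rel R" "(P, M') \<in> ideal_sum_rel R"
    unfolding ideal_sum_rel_iff using MaxSpec_subset_Spec by blast+
  then have "(M, M') \<in> spec_rel R"
    unfolding spec_rel_eq_trancl by (rule trancl_into_trancl [OF r_into_trancl])
  then show "M = M'"
    by (rule assms [OF M(1,2)])
qed

lemma gelfand_iff_spec_rel_class:
  "gelfand_ring R \<longleftrightarrow> (\<forall>M\<in>MaxSpec R. spec_rel R `` {M} = \<Lambda>\<^bsub>R\<^esub> M)"
proof
  assume G: "gelfand_ring R"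
  show "\<forall>M\<in>MaxSpec R. spec_rel R `` {M} = \<Lambda>\<^bsub>R\<^esub> M"
  proof
    fix M assume M: "M \<in> MaxSpec R"
    then have MS: "M \<in> Spec R"
      using MaxSpec_subset_Spec by blast
    have "maximal_above R M = M"
      by (rule gelfand_maximal_above_eq [OF G MS M order_refl])
    then have "spec_rel R `` {M} = {Q \<in> Spec R. maximal_above R Q = M}"
      unfolding Image_singleton gelfand_spec_rel_iff [OF G] using MS by auto
    moreover have "maximal_above R Q = M \<longleftrightarrow> Q \<subseteq> M" if "Q \<in> Spec R" for Q
      using gelfand_maximal_above_eq [OF G that M] gelfand_maximal_above(2) [OF G that] by blast
    then have "{Q \<in> Spec R. maximal_above R Q = M} = \<Lambda>\<^bsub>R\<^esub> M"
      unfolding generalizations_def by blast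
    ultimately show "spec_rel R `` {M} = \<Lambda>\<^bsub>R\<^esub> M"
      by simp
  qed
next
  assume *: "\<forall>M\<in>MaxSpec R. spec_rel R `` {M} = \<Lambda>\<^bsub>R\<^esub> M"
  show "gelfand_ring R"
  proof (rule spec_rel_class_eq_imp_gelfand)
    fix M M' assume M: "M \<in> MaxSpec R" "M' \<in> MaxSpec R" and "(M, M') \<in> spec_rel R"
    then have "M' \<in> spec_rel R `` {M}"
      by blast
    also have "\<dots> = \<Lambda>\<^bsub>R\<^esub> M"
      using * M(1) by (rule bspec)
    finally have "M' \<in> \<Lambda>\<^bsub>R\<^esub> M" .
    then have "M' \<subseteq> M"
      by (simp add: generalizations_def)
    moreover have "M \<in> Spec R"
      using M MaxSpec_subset_Spec by blast
    ultimately show "M = M'"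
      using MaxSpec_eqI [OF M(2) Spec_ideal Spec_one_notin] by blast
  qed
qed

text \<open>
  Every class contains exactly one maximal ideal, so \<open>\<eta>\<close> is bijective; it is continuous as a
  restriction of the quotient map. It is open because the preimage in the spectrum of \<open>\<eta> ` U\<close> is the
  preimage of \<open>U\<close> under the continuous map \<open>\<gamma>\<close> to the maximal ideal above. Conversely,
  injectivity of \<open>\<eta>\<close> forbids a class with two maximal ideals.
\<close>

lemma gelfand_iff_homeomorphic_quotient:
  "gelfand_ring R \<longleftrightarrow>
    homeomorphic_map (subtopology (zariski R) (MaxSpec R))
      (quotient_topology (zariski R) (spec_rel R)) (\<lambda>M. spec_rel R `` {M})"
    (is "_ \<longleftrightarrow> homeomorphic_map ?X ?Y ?\<eta>")
proof
  assume G: "gelfand_ring R"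
  let ?\<gamma> = "maximal_above R"
  have q: "quotient_map (zariski R) ?Y ?\<eta>"
    by (rule quotient_map_quotient_topology)
  have fixed: "?\<gamma> M = M" if "M \<in> MaxSpec R" for M
    using gelfand_maximal_above_eq [OF G _ that] that MaxSpec_subset_Spec by blast
  have class_eq: "?\<eta> P = ?\<eta> Q \<longleftrightarrow> ?\<gamma> P = ?\<gamma> Q" if "P \<in> Spec R" "Q \<in> Spec R" for P Q
    unfolding eq_equiv_class_iff [OF equiv_spec_rel that] gelfand_spec_rel_iff [OF G]
    using that by simp
  have class_max: "?\<eta> P = ?\<eta> (?\<gamma> P)" if P: "P \<in> Spec R" for P
  proof -
    have "?\<gamma> P \<in> MaxSpec R"
      by (rule gelfand_maximal_above [OF G P])
    then have "?\<gamma> P \<in> Spec R" "?\<gamma> P = ?\<gamma> (?\<gamma> P)"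
      using MaxSpec_subset_Spec fixed by auto
    then show ?thesis
      using class_eq [OF P, of "?\<gamma> P"] by blast
  qed
  show "homeomorphic_map ?X ?Y ?\<eta>"
  proof (rule bijective_open_imp_homeomorphic_map)
    show "continuous_map ?X ?Y ?\<eta>"
      by (rule continuous_map_from_subtopology [OF quotient_imp_continuous_map [OF q]])
    show "open_map ?X ?Y ?\<eta>"
      unfolding open_map_def
    proof (intro allI impI)
      fix U assume U: "openin ?X U"
      then have UM: "U \<subseteq> MaxSpec R"
        using openin_subset topspace_maximal by blast
      have "{P \<in> Spec R. ?\<eta> P \<in> ?\<eta> ` U} = {P \<in> Spec R. ?\<gamma> P \<in> U}"
      proof (intro Collect_cong conj_cong refl iffI)
        fix P assume P: "P \<in> Spec R"
        show "?\<gamma> P \<in> U" if "?\<eta> P \<in> ?\<eta> ` U"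
        proof -
          from that obtain M where M: "M \<in> U" "?\<eta> P = ?\<eta> M"
            by blast
          then have "?\<gamma> P = ?\<gamma> M"
            using class_eq [OF P, of M] UM MaxSpec_subset_Spec by blast
          then show ?thesis
            using M(1) fixed UM by auto
        qed
        show "?\<eta> P \<in> ?\<eta> ` U" if "?\<gamma> P \<in> U"
          using class_max [OF P] that by blast
      qed
      moreover have "openin (zariski R) {P \<in> Spec R. ?\<gamma> P \<in> U}"
        using openin_continuous_map_preimage [OF gelfand_continuous_maximal_above [OF G] U]
        by (simp add: topspace_zariski)
      moreover have "?\<eta> ` U \<subseteq> Spec R // spec_rel R"
        using UM MaxSpec_subset_Spec by (blast intro: quotientI)
      ultimately show "openin ?Y (?\<eta> ` U)"
        by (simp add: openin_quotient_topology topspace_zariski)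
    qed
    show "?\<eta> ` topspace ?X = topspace ?Y"
    proof -
      have "?\<eta> ` MaxSpec R = ?\<eta> ` Spec R"
      proof
        show "?\<eta> ` MaxSpec R \<subseteq> ?\<eta> ` Spec R"
          using MaxSpec_subset_Spec by (rule image_mono)
        show "?\<eta> ` Spec R \<subseteq> ?\<eta> ` MaxSpec R"
          using class_max gelfand_maximal_above(1) [OF G] by (intro image_subsetI) blast
      qed
      then show ?thesis
        using quotient_imp_surjective_map [OF q] unfolding topspace_maximal topspace_zariski by simp
    qed
    show "inj_on ?\<eta> (topspace ?X)"
      unfolding topspace_maximal
    proof (rule inj_onI)
      fix M M' assume M: "M \<in> MaxSpec R" "M' \<in> MaxSpec R" and eq: "?\<eta> M = ?\<eta> M'"
      then have "?\<gamma> M = ?\<gamma> M'"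
        using class_eq [of M M'] MaxSpec_subset_Spec by blast
      then show "M = M'"
        using fixed M by simp
    qed
  qed
next
  assume "homeomorphic_map ?X ?Y ?\<eta>"
  then have inj: "inj_on ?\<eta> (MaxSpec R)"
    unfolding homeomorphic_map_def topspace_maximal by blast
  show "gelfand_ring R"
  proof (rule spec_rel_class_eq_imp_gelfand)
    fix M M' assume M: "M \<in> MaxSpec R" "M' \<in> MaxSpec R" and "(M, M') \<in> spec_rel R"
    then have "?\<eta> M = ?\<eta> M'"
      by (intro equiv_class_eq [OF equiv_spec_rel])
    then show "M = M'"
      by (rule inj_onD [OF inj _ M])
  qed
qed

end

section \<open>The equivalence\<close>

theorem theorem4p3:
  fixes A :: "('a, 'b) ring_scheme" (structure)
  assumes "cring A"
  shows
    \<comment> \<open>(i) iff (ii)\<close>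
    "(gelfand_ring A \<longleftrightarrow> MaxSpec A retract_of_space zariski A) \<and>
    \<comment> \<open>(i) iff (iii)\<close>
     (gelfand_ring A \<longleftrightarrow> normal_space (zariski A)) \<and>
    \<comment> \<open>(i) iff (iv)\<close>
     (gelfand_ring A \<longleftrightarrow>
       (\<forall>f \<in> carrier A. \<exists>g \<in> carrier A. \<exists>h \<in> carrier A.
          (\<one> \<oplus> f \<otimes> g) \<otimes> (\<one> \<oplus> (\<one> \<ominus> f) \<otimes> h) = \<zero>)) \<and>
    \<comment> \<open>(i) iff (v)\<close>
     (gelfand_ring A \<longleftrightarrow>
       (\<forall>M \<in> MaxSpec A. \<forall>M' \<in> MaxSpec A. M \<noteq> M' \<longrightarrow>
          (\<exists>f \<in> carrier A - M. \<exists>g \<in> carrier A - M'. f \<otimes> g = \<zero>))) \<and>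
    \<comment> \<open>(i) iff (vi)\<close>
     (gelfand_ring A \<longleftrightarrow>
       (\<forall>M \<in> MaxSpec A. canonical_map A M ` carrier A = carrier (local_ring_at A M))) \<and>
    \<comment> \<open>(i) iff (vii)\<close>
     (gelfand_ring A \<longleftrightarrow> (\<forall>M \<in> MaxSpec A. spec_rel A `` {M} = \<Lambda> M)) \<and>
    \<comment> \<open>(i) iff (viii)\<close>
     (gelfand_ring A \<longleftrightarrow> (\<forall>M \<in> MaxSpec A. closedin (zariski A) (\<Lambda> M))) \<and>
    \<comment> \<open>(i) iff (ix)\<close>
     (gelfand_ring A \<longleftrightarrow>
       (\<forall>M \<in> MaxSpec A. \<forall>M' \<in> MaxSpec A. M \<noteq> M' \<longrightarrow>
          canonical_ker A M <+> canonical_ker A M' = carrier A)) \<and>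
    \<comment> \<open>(i) iff (x)\<close>
     (gelfand_ring A \<longleftrightarrow>
       (\<forall>M \<in> MaxSpec A. \<forall>M' \<in> MaxSpec A. M \<noteq> M' \<longrightarrow>
          (\<exists>f \<in> carrier A. canonical_map A M f = \<zero>\<^bsub>local_ring_at A M\<^esub> \<and>
             canonical_map A M' f = \<one>\<^bsub>local_ring_at A M'\<^esub>))) \<and>
    \<comment> \<open>(i) iff (xi)\<close>
     (gelfand_ring A \<longleftrightarrow>
       homeomorphic_map (subtopology (zariski A) (MaxSpec A))
         (quotient_topology (zariski A) (spec_rel A)) (\<lambda>M. spec_rel A `` {M})) \<and>
    \<comment> \<open>(i) iff (xii)\<close>
     (gelfand_ring A \<longleftrightarrow> (\<forall>M \<in> MaxSpec A. \<Lambda> M = vanishing_locus A (canonical_ker A M)))"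
proof -
  interpret cring A by fact
  show ?thesis
    by (intro conjI gelfand_iff_retract gelfand_iff_normal gelfand_iff_zero_product
        gelfand_iff_separation gelfand_iff_canonical_map_surj gelfand_iff_spec_rel_class
        gelfand_iff_closed_generalizations gelfand_iff_ker_comaximal gelfand_iff_interpolation
        gelfand_iff_homeomorphic_quotient gelfand_iff_generalizations_vanishing_ker)
qed

end
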